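(* Let $G_0$ be a snark, let $u_1,\dots,u_5$ be distinct vertices of $G_0$ such that $(u_1,u_2),(u_2,u_3),(u_3,u_4),(u_4,u_5)$ are edges of $G_0$, and let $v_2,v_3,v_4$ be vertices of $G_0$, distinct from the $u_m$'s, such that $(u_2,v_2),(u_3,v_3),(u_4,v_4)$ are edges of $G_0$. Let $G$ be the graph (a snark) obtained from $G_0$ and these vertices by superposition. Let $E := (v_3,c)$, an edge of $G$, and let $\epsilon := (u_3,v_3)$, an edge of $G_0$. Then $\psi(G,E) = 7\cdot \psi(G_0,\epsilon)$.
   Context: All graphs are undirected. A graph is simple if it is connected, has finitely many vertices, and has no loops or multiple edges; it is cubic if each vertex is attached to exactly 3 edges. A 3-edge-colouring assigns one of three colours to each edge so that no two adjacent edges receive the same colour. A 3-edge-decomposition is a partition of the edges into three (unordered) classes such that no two adjacent edges are in the same class. A snark is a simple cubic graph that is not 3-edge-colourable, has girth at least 5, and is at least cyclically 4-edge-connected (i.e. any two vertex-disjoint cycles are joined by 4 mutually edge-disjoint paths). Edge subtraction: given an edge $e=(u,v)$ of a cubic graph $G$, remove $e$; this leaves divalent vertices $u$ and $v$, with edges $(u,p_1),(u,p_2),(v,q_1),(v,q_2)$. Delete $u$ and $v$ and these edges, and form new edges $(p_1,p_2)$ and $(q_1,q_2)$. The resulting cubic graph is $G_e$. The number $\psi(G,e)$: for $G$ a simple, non-3-edge-colourable cubic graph and $e$ an edge of $G$, it is known that the number of 3-edge-decompositions of $G_e$ equals $3J$ for some nonnegative integer $J$ (possibly $0$); define $\psi(G,e)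 := J$. Equivalently, the number of 3-edge-colourings of $G_e$ (with a fixed set of three colours) is $18\,\psi(G,e)$. Superposition. Let $T$ be the graph (built from two Petersen graphs) with the 19 vertices $a,b,c,d,e,f,g,h,i,j,k,s_1,s_2,s_3,s_4,t_1,t_2,t_3,t_4$ and the 26 edges $(b,h),(h,c),(c,i),(i,d)$; $(a,f),(f,k),(k,e)$; $(g,j)$; $(b,s_1),(h,s_2),(a,s_3),(f,s_4)$; $(s_1,s_4),(s_4,s_2),(s_2,s_3),(s_3,g),(g,s_1)$; $(i,t_1),(d,t_2),(e,t_3),(k,t_4)$; $(j,t_3),(t_3,t_1),(t_1,t_4),(t_4,t_2),(t_2,j)$. The vertices $a,b,c,d,e$ are 2-valent in $T$; all others are 3-valent. Given a snark $G_0$ (disjoint from $T$) and vertices $u_1,\dots,u_5,v_2,v_3,v_4$ of $G_0$ as in the claim, the superposition $G$ is the cubic graph obtained from the disjoint union of $G_0$ and $T$ by deleting the vertices $u_2,u_3,u_4$ together with all edges attached to them (namely $(u_1,u_2),(u_2,u_3),(u_3,u_4),(u_4,u_5),(u_2,v_2),(u_3,v_3),(u_4,v_4)$), and inserting the five new edges $(u_1,a),(v_2,b),(v_3,c),(v_4,d),(u_5,e)$. It is known that $G$ is a snark. *)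

theory Defs
  imports "HOL-Library.Disjoint_Sets"
begin

text \<open>
  Undirected multigraphs: every edge has an identity of its own, and \<open>ends\<close> yields the set of its
  (one or two) end vertices. Multigraphs are needed because edge subtraction can create multiple
  edges.
\<close>

record ('v, 'e) graph =
  verts :: "'v set"
  edges :: "'e set"
  ends :: "'e \<Rightarrow> 'v set"

definition wf_graph :: "('v, 'e) graph \<Rightarrow> bool" where
  "wf_graph G \<longleftrightarrow> (\<forall>e\<in>edges G. ends G e \<subseteq> verts G \<and> card (ends G e) \<in> {1, 2})"

definition joins :: "('v, 'e) graph \<Rightarrow> 'e \<Rightarrow> 'v \<Rightarrow> 'v \<Rightarrow> bool" where
  "joins G e u v \<longleftrightarrow> e \<in> edges G \<and> ends G e = {u, v}"

definition adjacent_edges :: "('v, 'e) graph \<Rightarrow> 'e \<Rightarrow> 'e \<Rightarrow> bool" where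
  "adjacent_edges G e f \<longleftrightarrow> e \<in> edges G \<and> f \<in> edges G \<and> e \<noteq> f \<and> ends G e \<inter> ends G f \<noteq> {}"

text \<open>Walks, paths and cycles are given by their list of vertices and their list of edges.\<close>

definition is_walk :: "('v, 'e) graph \<Rightarrow> 'v list \<Rightarrow> 'e list \<Rightarrow> bool" where
  "is_walk G vs es \<longleftrightarrow>
     length vs = Suc (length es) \<and> set vs \<subseteq> verts G \<and>
     (\<forall>i<length es. joins G (es ! i) (vs ! i) (vs ! Suc i))"

definition is_path :: "('v, 'e) graph \<Rightarrow> 'v list \<Rightarrow> 'e list \<Rightarrow> bool" where
  "is_path G vs es \<longleftrightarrow> is_walk G vs es \<and> distinct vs"

text \<open>
  The first vertex of a cycle is repeated at the end of its vertex list. Distinctness of the edges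
  excludes running back and forth along one edge; loops and pairs of parallel edges are cycles of
  length 1 and 2.
\<close>

definition is_cycle :: "('v, 'e) graph \<Rightarrow> 'v list \<Rightarrow> 'e list \<Rightarrow> bool" where
  "is_cycle G vs es \<longleftrightarrow>
     is_walk G vs es \<and> es \<noteq> [] \<and> hd vs = last vs \<and> distinct (tl vs) \<and> distinct es"

definition connected_graph :: "('v, 'e) graph \<Rightarrow> bool" where
  "connected_graph G \<longleftrightarrow>
     (\<forall>u\<in>verts G. \<forall>v\<in>verts G. \<exists>vs es. is_path G vs es \<and> hd vs = u \<and> last vs = v)"

definition simple_graph :: "('v, 'e) graph \<Rightarrow> bool" where
  "simple_graph G \<longleftrightarrow>
     wf_graph G \<and> connected_graph G \<and> finite (verts G) \<and>
     (\<forall>e\<in>edges G. card (ends G e) = 2) \<and> inj_on (ends G) (edges G)"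

text \<open>A loop would be counted once here; the notion is only used for loopless graphs.\<close>

definition cubic :: "('v, 'e) graph \<Rightarrow> bool" where
  "cubic G \<longleftrightarrow> (\<forall>v\<in>verts G. card {e \<in> edges G. v \<in> ends G e} = 3)"

definition edge_colouring3 :: "('v, 'e) graph \<Rightarrow> ('e \<Rightarrow> nat) \<Rightarrow> bool" where
  "edge_colouring3 G c \<longleftrightarrow>
     c ` edges G \<subseteq> {0, 1, 2} \<and> (\<forall>e f. adjacent_edges G e f \<longrightarrow> c e \<noteq> c f)"

definition edge_colourable3 :: "('v, 'e) graph \<Rightarrow> bool" where
  "edge_colourable3 G \<longleftrightarrow> (\<exists>c. edge_colouring3 G c)"

text \<open>
  The three classes of a decomposition are nonempty by \<^const>\<open>partition_on\<close>. This is no restriction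
  for a cubic graph with at least one vertex, since each vertex meets all three classes.
\<close>

definition edge_decomposition3 :: "('v, 'e) graph \<Rightarrow> 'e set set \<Rightarrow> bool" where
  "edge_decomposition3 G P \<longleftrightarrow>
     partition_on (edges G) P \<and> card P = 3 \<and>
     (\<forall>X\<in>P. \<forall>e\<in>X. \<forall>f\<in>X. \<not> adjacent_edges G e f)"

definition girth_at_least :: "nat \<Rightarrow> ('v, 'e) graph \<Rightarrow> bool" where
  "girth_at_least n G \<longleftrightarrow> (\<forall>vs es. is_cycle G vs es \<longrightarrow> n \<le> length es)"

definition cyclically_edge_connected :: "nat \<Rightarrow> ('v, 'e) graph \<Rightarrow> bool" where
  "cyclically_edge_connected n G \<longleftrightarrow>
     (\<forall>vs es ws fs. is_cycle G vs es \<and> is_cycle G ws fs \<and> set vs \<inter> set ws = {} \<longrightarrow>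
        (\<exists>p q. (\<forall>i<n. is_path G (p i) (q i) \<and> hd (p i) \<in> set vs \<and> last (p i) \<in> set ws) \<and>
               (\<forall>i<n. \<forall>j<n. i \<noteq> j \<longrightarrow> set (q i) \<inter> set (q j) = {})))"

definition snark :: "('v, 'e) graph \<Rightarrow> bool" where
  "snark G \<longleftrightarrow>
     simple_graph G \<and> cubic G \<and> \<not> edge_colourable3 G \<and>
     girth_at_least 5 G \<and> cyclically_edge_connected 4 G"

text \<open>
  Edge subtraction. For each of the two ends \<open>w\<close> of the subtracted edge \<open>e\<close> there is one new edge
  \<open>Inr w\<close>, which joins the two neighbours of \<open>w\<close> along the edges other than \<open>e\<close>. The new edges are
  labelled, so they stay distinct from each other and from old edges with the same end vertices.
\<close>

definition subtract_edge :: "('v, 'e) graph \<Rightarrow> 'e \<Rightarrow> ('v, 'e + 'v) graph" where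
  "subtract_edge G e =
     \<lparr> verts = verts G - ends G e,
       edges = Inl ` {f \<in> edges G. ends G f \<inter> ends G e = {}} \<union> Inr ` ends G e,
       ends = case_sum (ends G)
                (\<lambda>w. {p. \<exists>f\<in>edges G. f \<noteq> e \<and> w \<in> ends G f \<and> p \<in> ends G f \<and> p \<noteq> w}) \<rparr>"

text \<open>
  Only meaningful for an edge \<open>e\<close> of a simple, cubic, not 3-edge-colourable graph \<open>G\<close>, in which case
  the number of decompositions is a multiple of 3.
\<close>

definition psi :: "('v, 'e) graph \<Rightarrow> 'e \<Rightarrow> nat" where
  "psi G e = (THE J. card {P. edge_decomposition3 (subtract_edge G e) P} = 3 * J)"

text \<open>
  The graph \<open>T\<close>, built from two Petersen graphs; \<open>Ta\<close>, \<open>Tb\<close>, \<open>Tc\<close>, \<open>Td\<close>, \<open>Te\<close> are its 2-valent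
  vertices.
\<close>

datatype tvert =
  Ta | Tb | Tc | Td | Te | Tf | Tg | Th | Ti | Tj | Tk |
  Ts1 | Ts2 | Ts3 | Ts4 | Tt1 | Tt2 | Tt3 | Tt4

definition T_edges :: "tvert set set" where
  "T_edges =
     {{Tb, Th}, {Th, Tc}, {Tc, Ti}, {Ti, Td},
      {Ta, Tf}, {Tf, Tk}, {Tk, Te},
      {Tg, Tj},
      {Tb, Ts1}, {Th, Ts2}, {Ta, Ts3}, {Tf, Ts4},
      {Ts1, Ts4}, {Ts4, Ts2}, {Ts2, Ts3}, {Ts3, Tg}, {Tg, Ts1},
      {Ti, Tt1}, {Td, Tt2}, {Te, Tt3}, {Tk, Tt4},
      {Tj, Tt3}, {Tt3, Tt1}, {Tt1, Tt4}, {Tt4, Tt2}, {Tt2, Tj}}"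

text \<open>
  The edges of the superposition: surviving edges of \<open>G\<^sub>0\<close>, edges of \<open>T\<close>, and the inserted edges
  between a vertex of \<open>G\<^sub>0\<close> and a vertex of \<open>T\<close>.
\<close>

datatype ('v, 'e) sup_edge = Base 'e | Gadget "tvert set" | Link 'v tvert

primrec sup_ends :: "('v, 'e) graph \<Rightarrow> ('v, 'e) sup_edge \<Rightarrow> ('v + tvert) set" where
  "sup_ends G (Base e) = Inl ` ends G e"
| "sup_ends G (Gadget x) = Inr ` x"
| "sup_ends G (Link v t) = {Inl v, Inr t}"

definition superposition ::
  "('v, 'e) graph \<Rightarrow> 'v \<Rightarrow> 'v \<Rightarrow> 'v \<Rightarrow> 'v \<Rightarrow> 'v \<Rightarrow> 'v \<Rightarrow> 'v \<Rightarrow> 'v \<Rightarrow>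
     ('v + tvert, ('v, 'e) sup_edge) graph" where
  "superposition G u1 u2 u3 u4 u5 v2 v3 v4 =
     \<lparr> verts = Inl ` (verts G - {u2, u3, u4}) \<union> Inr ` UNIV,
       edges = Base ` {e \<in> edges G. ends G e \<inter> {u2, u3, u4} = {}} \<union> Gadget ` T_edges \<union>
               {Link u1 Ta, Link v2 Tb, Link v3 Tc, Link v4 Td, Link u5 Te},
       ends = sup_ends G \<rparr>"

end

theory Submission
  imports Defs "HOL-Library.FuncSet"
begin

text \<open>
  Let \<open>G\<^sub>E\<close> and \<open>G'\<close> arise from \<open>G\<close> and \<open>G\<^sub>0\<close> by subtracting \<open>E\<close> and \<open>\<epsilon>\<close>. Without the gadget,
  \<open>G\<^sub>E\<close> is the same graph as \<open>G'\<close> without \<open>u\<^sub>2\<close> and \<open>u\<^sub>4\<close>, with four dangling edges at \<open>u\<^sub>1\<close>, \<open>v\<^sub>2\<close>,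
  \<open>v\<^sub>4\<close>, \<open>u\<^sub>5\<close>. In \<open>G'\<close> the edge joining \<open>u\<^sub>2\<close> and \<open>u\<^sub>4\<close> admits exactly the boundary colours in which
  the edges at \<open>u\<^sub>1\<close>, \<open>v\<^sub>2\<close> differ and those at \<open>v\<^sub>4\<close>, \<open>u\<^sub>5\<close> use the same two colours, each in one
  way. An exhaustive search shows that the gadget admits exactly the same boundary colours, each in
  seven ways. Hence \<open>G\<^sub>E\<close> has seven times as many colourings as \<open>G'\<close>. The factor 3 in the definition
  of \<open>\<psi>(G\<^sub>0, \<epsilon>)\<close> comes from Kempe chains: in \<open>G'\<close>, a chain through one of the two new edges cannot
  contain the other, or else \<open>G\<^sub>0\<close> would be 3-edge-colourable, so the colour of one new edge can be
  changed freely relative to that of the other.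
\<close>

section \<open>Decompositions and colourings\<close>

definition incident :: "('v, 'e) graph \<Rightarrow> 'v \<Rightarrow> 'e set" where
  "incident X w = {e \<in> edges X. w \<in> ends X e}"

lemma incident_subset: "incident X w \<subseteq> edges X"
  by (simp add: incident_def)

text \<open>Distinct edges are adjacent exactly when some vertex is incident with both, so
  properness can be checked one vertex at a time. All later arguments use this local form.\<close>

lemma edge_colouring3_iff:
  "edge_colouring3 X c \<longleftrightarrow> c ` edges X \<subseteq> {0, 1, 2} \<and> (\<forall>w. inj_on c (incident X w))"
proof -
  have "(\<forall>f g. adjacent_edges X f g \<longrightarrow> c f \<noteq> c g) \<longleftrightarrow> (\<forall>w. inj_on c (incident X w))"
    by (auto simp: adjacent_edges_def incident_def inj_on_def disjoint_iff)
  then show ?thesis by (simp add: edge_colouring3_def)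
qed

text \<open>Extensional functions: a colouring is determined by its values on the edges, so that the
  set can be counted.\<close>

definition colourings :: "('v, 'e) graph \<Rightarrow> ('e \<Rightarrow> nat) set" where
  "colourings X = {c \<in> edges X \<rightarrow>\<^sub>E {0, 1, 2}. \<forall>w. inj_on c (incident X w)}"

lemma colouring_range: "c \<in> colourings X \<Longrightarrow> f \<in> edges X \<Longrightarrow> c f \<in> {0, 1, 2}"
  using PiE_mem[of c "edges X" "\<lambda>_. {0, 1, 2}" f] by (simp only: colourings_def mem_Collect_eq)

lemma restrict_colouring:
  assumes "c ` edges X \<subseteq> {0, 1, 2}" "\<And>w. inj_on c (incident X w)"
  shows "restrict c (edges X) \<in> colourings X"
proof -
  have "inj_on (restrict c (edges X)) (incident X w)" for w
    using assms(2)[of w] by (simp add: inj_on_def incident_def)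
  then show ?thesis using assms(1) by (auto simp: colourings_def)
qed

text \<open>
  A decomposition consists of the colour classes of six colourings; exactly one of them gives the
  colours 0 and 1 to two edges that always lie in different classes.
\<close>

lemma card_decompositions:
  fixes Y :: "('v, 'e) graph"
  assumes f: "f0 \<in> edges Y" "f1 \<in> edges Y"
    and neq: "\<And>c. c \<in> colourings Y \<Longrightarrow> c f0 \<noteq> c f1"
    and sur: "\<And>c. c \<in> colourings Y \<Longrightarrow> {0, 1, 2} \<subseteq> c ` edges Y"
  shows "card {P. edge_decomposition3 Y P} = card {c \<in> colourings Y. c f0 = 0 \<and> c f1 = 1}"
proof -
  define cls where "cls c k = {f \<in> edges Y. c f = k}" for c and k :: nat
  define Q where "Q c = cls c ` {0, 1, 2}" for c
  let ?A = "{c \<in> colourings Y. c f0 = 0 \<and> c f1 = 1}"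
  have dec: "edge_decomposition3 Y (Q c)" if c: "c \<in> colourings Y" for c
  proof -
    have ne: "cls c k \<noteq> {}" if "k \<in> {0, 1, 2}" for k
      using sur[OF c] that by (auto simp: cls_def image_def)
    have inj: "inj_on (cls c) {0, 1, 2}"
    proof (rule inj_onI)
      fix k l assume kl: "k \<in> {0, 1, 2}" "cls c k = cls c l"
      obtain f where "f \<in> cls c k" using ne[OF kl(1)] by blast
      then show "k = l" using kl(2) by (auto simp: cls_def)
    qed
    have "card (Q c) = card {0, 1, 2::nat}" unfolding Q_def by (rule card_image[OF inj])
    then have "card (Q c) = 3" by simp
    moreover have "partition_on (edges Y) (Q c)"
    proof (rule partition_onI)
      show "\<Union> (Q c) = edges Y" using c by (fastforce simp: Q_def cls_def colourings_def PiE_def Pi_def)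
      show "disjnt p q" if "p \<in> Q c" "q \<in> Q c" "p \<noteq> q" for p q
        using that by (auto simp: Q_def cls_def disjnt_def)
      show "{} \<notin> Q c" using ne unfolding Q_def by (metis imageE)
    qed
    moreover have "\<not> adjacent_edges Y f g" if "p \<in> Q c" "f \<in> p" "g \<in> p" for p f g
    proof
      assume adj: "adjacent_edges Y f g"
      then obtain w where "f \<in> incident Y w" "g \<in> incident Y w" "f \<noteq> g"
        by (auto simp: adjacent_edges_def incident_def)
      moreover have "c f = c g" using that by (auto simp: Q_def cls_def)
      ultimately show False using c unfolding colourings_def inj_on_def by blast
    qed
    ultimately show ?thesis unfolding edge_decomposition3_def by blast
  qed
  \<comment> \<open>Fixing the colours of \<open>f0\<close> and \<open>f1\<close> as 0 and 1 selects
    one of the six numberings of the classes; \<open>Q\<close> forgets the numbering.\<close>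
  have "bij_betw Q ?A {P. edge_decomposition3 Y P}"
  proof (rule bij_betw_imageI)
    show "inj_on Q ?A"
    proof (rule inj_onI)
      fix c d assume c: "c \<in> ?A" and d: "d \<in> ?A" and eq: "Q c = Q d"
      have same: "cls c (c f) = cls d (d f)" if "f \<in> edges Y" for f
      proof -
        have "c f \<in> {0, 1, 2}" using c that colouring_range[of c Y f] by simp
        then have "cls c (c f) \<in> Q c" unfolding Q_def by (rule imageI)
        then have "cls c (c f) \<in> Q d" unfolding eq .
        then obtain k where k: "cls c (c f) = cls d k" unfolding Q_def by (rule imageE)
        moreover have "f \<in> cls c (c f)" using that by (simp add: cls_def)
        ultimately have "k = d f" by (simp add: cls_def)
        then show ?thesis using k by simp
      qed
      have 0: "cls c 0 = cls d 0" using same[OF f(1)] c d by simp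
      have 1: "cls c 1 = cls d 1" using same[OF f(2)] c d by simp
      show "c = d"
      proof (rule PiE_ext)
        show c': "c \<in> edges Y \<rightarrow>\<^sub>E {0, 1, 2}" and d': "d \<in> edges Y \<rightarrow>\<^sub>E {0, 1, 2}"
          using c d by (auto simp: colourings_def)
        fix f assume "f \<in> edges Y"
        then show "c f = d f"
          using PiE_mem[OF c', of f] PiE_mem[OF d', of f] 0[unfolded cls_def set_eq_iff, rule_format, of f]
            1[unfolded cls_def set_eq_iff, rule_format, of f] by auto
      qed
    qed
    show "Q ` ?A = {P. edge_decomposition3 Y P}"
    proof (intro equalityI subsetI)
      fix P assume "P \<in> Q ` ?A" then show "P \<in> {P. edge_decomposition3 Y P}" using dec by blast
    next
      fix P assume "P \<in> {P. edge_decomposition3 Y P}"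
      then have part: "partition_on (edges Y) P" and card: "card P = 3"
        and nadj: "\<And>p f g. p \<in> P \<Longrightarrow> f \<in> p \<Longrightarrow> g \<in> p \<Longrightarrow> \<not> adjacent_edges Y f g"
        by (auto simp: edge_decomposition3_def)
      \<comment> \<open>Any order of the three classes gives a colouring: edges of equal colour lie
        in a common class and hence are not adjacent.\<close>
      have col: "restrict (\<lambda>f. if f \<in> p then 0 else if f \<in> q then 1 else 2) (edges Y) \<in> colourings Y"
        if P: "P = {p, q, r}" for p q r
      proof (rule restrict_colouring)
        let ?c = "\<lambda>f. if f \<in> p then 0 else if f \<in> q then 1 else (2::nat)"
        show "?c ` edges Y \<subseteq> {0, 1, 2}" by auto
        fix w
        show "inj_on ?c (incident Y w)"
        proof (rule inj_onI, rule ccontr)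
          fix f g assume fg: "f \<in> incident Y w" "g \<in> incident Y w" "?c f = ?c g" "f \<noteq> g"
          then have adj: "adjacent_edges Y f g" by (auto simp: adjacent_edges_def incident_def)
          have "f \<in> \<Union> P" "g \<in> \<Union> P"
            using fg part by (auto simp: incident_def partition_on_def)
          then have "\<exists>s\<in>P. f \<in> s \<and> g \<in> s" using fg(3) unfolding P by (auto split: if_splits)
          then show False using nadj adj by blast
        qed
      qed
      obtain p q where pq: "p \<in> P" "f0 \<in> p" "q \<in> P" "f1 \<in> q"
        using f part unfolding partition_on_def by blast
      have rest: "\<exists>r. P = {p, q', r} \<and> r \<noteq> p \<and> r \<noteq> q'" if "p \<noteq> q'" "q' \<in> P" for q'
      proof -
        have "card (P - {p, q'}) = 1" using card that pq by (simp add: card_Diff_subset)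
        then obtain r where "P - {p, q'} = {r}" by (auto simp: card_1_singleton_iff)
        then show ?thesis using that pq by blast
      qed
      \<comment> \<open>If \<open>f0\<close> and \<open>f1\<close> shared a class, numbering the
        classes would give a colouring in which they agree, against \<open>neq\<close>.\<close>
      have "p \<noteq> q"
      proof
        assume "p = q"
        have "\<exists>q'\<in>P. q' \<noteq> p"
        proof (rule ccontr)
          assume "\<not> ?thesis" then have "P \<subseteq> {p}" by blast
          then have "card P \<le> 1" using card_mono[of "{p}" P] by simp
          then show False using card by simp
        qed
        then obtain q' where q': "q' \<in> P" "p \<noteq> q'" by blast
        obtain r where "P = {p, q', r}" using rest[OF q'(2,1)] by blast
        from neq[OF col[OF this]] show False using pq f \<open>p = q\<close> by simp
      qed
      then obtain r where P: "P = {p, q, r}" and r: "r \<noteq> p" "r \<noteq> q"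
        using rest[OF _ pq(3)] by blast
      define c where "c = restrict (\<lambda>f. if f \<in> p then 0 else if f \<in> q then 1 else (2::nat)) (edges Y)"
      have disj: "p \<inter> q = {}" "p \<inter> r = {}" "q \<inter> r = {}"
        using part r \<open>p \<noteq> q\<close> disjointD[of P] unfolding partition_on_def by (simp_all add: P)
      have un: "edges Y = p \<union> q \<union> r" using partition_onD1[OF part] by (simp add: P Un_assoc)
      have "cls c 0 = p" "cls c 1 = q" "cls c 2 = r"
        using disj un by (auto simp: cls_def c_def)
      then have "Q c = P" by (simp add: Q_def P)
      moreover have "c \<in> ?A" using col[OF P] pq f disj by (auto simp: c_def)
      ultimately show "P \<in> Q ` ?A" by blast
    qed
  qed
  then show ?thesis by (simp add: bij_betw_same_card)
qed

text \<open>
  The colourings of the graph obtained by subtracting \<open>e\<close>, described on the original edges: the two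
  edges that remain at an end of \<open>e\<close> become one edge, hence must agree.
\<close>

definition cut_colourings :: "('v, 'e) graph \<Rightarrow> 'e \<Rightarrow> ('e \<Rightarrow> nat) set" where
  "cut_colourings X e = {d \<in> (edges X - {e}) \<rightarrow>\<^sub>E {0, 1, 2}.
     (\<forall>w. w \<notin> ends X e \<longrightarrow> inj_on d (incident X w)) \<and>
     (\<forall>w\<in>ends X e. \<forall>f\<in>incident X w - {e}. \<forall>g\<in>incident X w - {e}. d f = d g)}"

section \<open>Edge subtraction as a merging of edges\<close>

locale edge_cut =
  fixes X :: "('v, 'e) graph" and e :: 'e
  assumes card_ends: "\<And>f. f \<in> edges X \<Longrightarrow> card (ends X f) = 2"
    and inj_ends: "inj_on (ends X) (edges X)"
    and e_edge: "e \<in> edges X"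
    and other_edge: "\<And>w. w \<in> ends X e \<Longrightarrow> incident X w \<noteq> {e}"
begin

lemma ends_eq: "ends X f = {v, w}" if f: "f \<in> edges X" and "v \<in> ends X f" "w \<in> ends X f" "v \<noteq> w"
proof -
  obtain x y where "ends X f = {x, y}" using card_ends[OF f] by (auto simp: card_2_iff)
  then show ?thesis using that by auto
qed

lemma edge_eqI:
  assumes "f \<in> edges X" "g \<in> edges X" "v \<noteq> w"
    "v \<in> ends X f" "w \<in> ends X f" "v \<in> ends X g" "w \<in> ends X g"
  shows "f = g"
  using assms ends_eq[of f v w] ends_eq[of g v w] inj_onD[OF inj_ends, of f g] by simp

text \<open>The edge of the subtracted graph into which an old edge is absorbed. For an edge other
  than \<open>e\<close> the choice of a common end is forced, since a second common end would make
  it parallel to \<open>e\<close>.\<close>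

definition merge :: "'e \<Rightarrow> 'e + 'v" where
  "merge f = (if ends X f \<inter> ends X e = {} then Inl f else Inr (SOME w. w \<in> ends X f \<inter> ends X e))"

lemma merge_Inr:
  assumes f: "f \<in> edges X" "f \<noteq> e" and w: "w \<in> ends X f" "w \<in> ends X e"
  shows "merge f = Inr w"
proof -
  have "(SOME w. w \<in> ends X f \<inter> ends X e) = w"
  proof (rule some_equality)
    show "w \<in> ends X f \<inter> ends X e" using w by simp
    fix v assume "v \<in> ends X f \<inter> ends X e"
    then show "v = w" using edge_eqI[of f e v w] f w e_edge by blast
  qed
  moreover have "ends X f \<inter> ends X e \<noteq> {}" using w by blast
  ultimately show ?thesis unfolding merge_def by simp
qed

lemma merge_cases:
  assumes "f \<in> edges X" "f \<noteq> e"
  obtains "ends X f \<inter> ends X e = {}" "merge f = Inl f"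
    | w where "w \<in> ends X f" "w \<in> ends X e" "merge f = Inr w"
proof (cases "ends X f \<inter> ends X e = {}")
  case True
  then show ?thesis using that(1) by (simp add: merge_def)
next
  case False
  then obtain w where "w \<in> ends X f" "w \<in> ends X e" by blast
  then show ?thesis using that(2) merge_Inr assms by blast
qed

lemma merge_InlD: "merge f = Inl g \<Longrightarrow> f = g"
  by (simp add: merge_def split: if_splits)

lemma merge_InrD: "merge f = Inr w \<Longrightarrow> w \<in> ends X f \<inter> ends X e"
  using some_in_eq[of "ends X f \<inter> ends X e"] by (auto simp: merge_def split: if_splits)

text \<open>A new edge \<open>Inr w\<close> has a preimage because \<open>e\<close> is not the only
  edge at \<open>w\<close>.\<close>

lemma merge_image: "merge ` (edges X - {e}) = edges (subtract_edge X e)"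
proof (intro equalityI subsetI)
  fix y assume "y \<in> merge ` (edges X - {e})"
  then obtain f where f: "f \<in> edges X" "f \<noteq> e" "y = merge f" by auto
  from f(1,2) show "y \<in> edges (subtract_edge X e)"
    by (rule merge_cases) (use f in \<open>auto simp: subtract_edge_def\<close>)
next
  fix y assume "y \<in> edges (subtract_edge X e)"
  then consider f where "y = Inl f" "f \<in> edges X" "ends X f \<inter> ends X e = {}"
    | w where "y = Inr w" "w \<in> ends X e" by (auto simp: subtract_edge_def)
  then show "y \<in> merge ` (edges X - {e})"
  proof cases
    case 1
    then have "f \<noteq> e" using card_ends[OF e_edge] by auto
    then show ?thesis using 1 by (auto simp: merge_def image_iff intro!: bexI[of _ f])
  next
    case 2
    have "e \<in> incident X w" using 2 e_edge by (simp add: incident_def)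
    then obtain f where "f \<in> incident X w" "f \<noteq> e" using other_edge[OF 2(2)] by blast
    then show ?thesis using 2 merge_Inr[of f w] by (auto simp: incident_def image_iff intro!: bexI[of _ f])
  qed
qed

text \<open>A new edge cannot have an end on \<open>e\<close>: the old edge supplying that end would
  be parallel to \<open>e\<close>. At all other vertices incidence is inherited through
  \<open>merge\<close>.\<close>

lemma incident_subtract:
  "incident (subtract_edge X e) w = (if w \<in> ends X e then {} else merge ` incident X w)"
proof (cases "w \<in> ends X e")
  case True
  have False if "v \<in> ends X e" "f \<in> edges X" "f \<noteq> e" "v \<in> ends X f" "w \<in> ends X f" "w \<noteq> v" for v f
    using edge_eqI[of f e v w] that True e_edge by blast
  then show ?thesis using True by (auto simp: incident_def subtract_edge_def)
next
  case False
  have "incident (subtract_edge X e) w = merge ` incident X w"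
  proof (intro equalityI subsetI)
    fix y assume "y \<in> incident (subtract_edge X e) w"
    then consider f where "y = Inl f" "f \<in> edges X" "ends X f \<inter> ends X e = {}" "w \<in> ends X f"
      | v f where "y = Inr v" "v \<in> ends X e" "f \<in> edges X" "f \<noteq> e" "v \<in> ends X f" "w \<in> ends X f"
      by (auto simp: incident_def subtract_edge_def)
    then show "y \<in> merge ` incident X w"
    proof cases
      case 1
      then show ?thesis by (auto simp: merge_def incident_def image_iff intro!: bexI[of _ f])
    next
      case 2
      then show ?thesis using merge_Inr[of f v]
        by (auto simp: incident_def image_iff intro!: bexI[of _ f])
    qed
  next
    fix y assume "y \<in> merge ` incident X w"
    then obtain f where f: "f \<in> edges X" "w \<in> ends X f" "y = merge f" by (auto simp: incident_def)
    then have fe: "f \<noteq> e" using False by auto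
    from f(1) fe show "y \<in> incident (subtract_edge X e) w"
      by (rule merge_cases) (use f fe False in \<open>auto simp: incident_def subtract_edge_def\<close>)
  qed
  then show ?thesis using False by simp
qed

text \<open>Two edges at \<open>w\<close> that merge share an end of \<open>e\<close> besides
  \<open>w\<close>, so they have both ends in common and coincide.\<close>

lemma inj_on_merge: "inj_on merge (incident X w)" if "w \<notin> ends X e"
proof (rule inj_onI)
  fix f g assume f: "f \<in> incident X w" and g: "g \<in> incident X w" and eq: "merge f = merge g"
  have fe: "f \<in> edges X" "f \<noteq> e" and ge: "g \<in> edges X" "g \<noteq> e"
    using f g that by (auto simp: incident_def)
  from fe show "f = g"
  proof (rule merge_cases)
    assume "merge f = Inl f"
    then show ?thesis using eq merge_InlD[of g f] by simp
  next
    fix v assume v: "v \<in> ends X f" "v \<in> ends X e" "merge f = Inr v"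
    then have "v \<in> ends X g" using eq merge_InrD[of g v] by simp
    then show ?thesis using edge_eqI[of f g v w] v f g that by (auto simp: incident_def)
  qed
qed

lemma inj_on_colouring_iff:
  "inj_on c (incident (subtract_edge X e) w) \<longleftrightarrow> w \<in> ends X e \<or> inj_on (c \<circ> merge) (incident X w)"
  using inj_on_merge[of w] comp_inj_on_iff[of merge "incident X w" c]
  by (auto simp: incident_subtract)

text \<open>This makes the induced colouring of the merged edges well defined: distinct edges merge
  only at a common end of \<open>e\<close>, where a cut colouring is constant.\<close>

lemma cut_colouring_merge_eq:
  assumes d: "d \<in> cut_colourings X e" and f: "f \<in> edges X - {e}" and g: "g \<in> edges X - {e}"
    and eq: "merge f = merge g"
  shows "d f = d g"
proof -
  from f have "f \<in> edges X" "f \<noteq> e" by auto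
  then show ?thesis
  proof (rule merge_cases)
    assume "merge f = Inl f"
    then show ?thesis using eq merge_InlD[of g f] by simp
  next
    fix v assume v: "v \<in> ends X f" "v \<in> ends X e" "merge f = Inr v"
    then have "v \<in> ends X g" using eq merge_InrD[of g v] by simp
    then have "f \<in> incident X v - {e}" "g \<in> incident X v - {e}"
      using v f g by (auto simp: incident_def)
    then show ?thesis using d v(2) unfolding cut_colourings_def by blast
  qed
qed

lemma bij_betw_cut_colourings:
  "bij_betw (\<lambda>c. restrict (c \<circ> merge) (edges X - {e})) (colourings (subtract_edge X e)) (cut_colourings X e)"
proof -
  let ?E = "edges X - {e}" and ?Y = "subtract_edge X e"
  let ?F = "\<lambda>c. restrict (c \<circ> merge) ?E"
  \<comment> \<open>The inverse map colours each edge of the subtracted graph like an arbitrarily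
    chosen old edge that merges into it.\<close>
  let ?H = "\<lambda>d. restrict (d \<circ> inv_into ?E merge) (edges ?Y)"
  have inc: "incident X w \<subseteq> ?E" if "w \<notin> ends X e" for w
    using that by (auto simp: incident_def)
  have inv: "inv_into ?E merge y \<in> ?E" "merge (inv_into ?E merge y) = y" if "y \<in> edges ?Y" for y
    using that merge_image inv_into_into[of y merge ?E] f_inv_into_f[of y merge ?E] by auto
  have F: "?F c \<in> cut_colourings X e" if c: "c \<in> colourings ?Y" for c
  proof -
    have "?F c \<in> ?E \<rightarrow>\<^sub>E {0, 1, 2}"
    proof (rule restrict_PiE_iff[THEN iffD2], rule ballI)
      fix f assume "f \<in> ?E"
      then have "merge f \<in> edges ?Y" using merge_image by blast
      moreover have "c \<in> edges ?Y \<rightarrow> {0, 1, 2}" using c by (simp add: colourings_def PiE_def)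
      ultimately have "c (merge f) \<in> {0, 1, 2}" by (rule funcset_mem[rotated])
      then show "(c \<circ> merge) f \<in> {0, 1, 2}" by simp
    qed
    moreover have "inj_on (?F c) (incident X w)" if "w \<notin> ends X e" for w
    proof -
      have "inj_on (c \<circ> merge) (incident X w)"
        using inj_on_colouring_iff[of c w] c that by (auto simp: colourings_def)
      then show ?thesis
        by (rule inj_on_cong[THEN iffD1, rotated]) (use inc[OF that] in auto)
    qed
    moreover have "?F c f = ?F c g"
      if "w \<in> ends X e" "f \<in> incident X w - {e}" "g \<in> incident X w - {e}" for w f g
      using that merge_Inr[of _ w] by (auto simp: incident_def)
    ultimately show ?thesis unfolding cut_colourings_def by blast
  qed
  have HF: "(?H d \<circ> merge) f = d f" if "d \<in> cut_colourings X e" "f \<in> ?E" for d f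
  proof -
    have y: "merge f \<in> edges ?Y" using that merge_image by blast
    then show ?thesis using inv[OF y] cut_colouring_merge_eq[OF that(1) _ that(2)] by simp
  qed
  have H: "?H d \<in> colourings ?Y" if d: "d \<in> cut_colourings X e" for d
  proof (rule restrict_colouring)
    have dom: "d f \<in> {0, 1, 2}" if "f \<in> ?E" for f
      using d that unfolding cut_colourings_def by blast
    then show "(d \<circ> inv_into ?E merge) ` edges ?Y \<subseteq> {0, 1, 2}" using inv(1) by force
    fix w
    have "inj_on (?H d) (incident ?Y w)"
    proof (cases "w \<in> ends X e")
      case True then show ?thesis by (simp add: incident_subtract)
    next
      case False
      have "inj_on d (incident X w)" using d False by (simp add: cut_colourings_def)
      then have "inj_on (?H d \<circ> merge) (incident X w)"
        by (rule inj_on_cong[THEN iffD1, rotated]) (use HF[OF d, symmetric] inc[OF False] in blast)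
      then show ?thesis using inj_on_colouring_iff by blast
    qed
    then show "inj_on (d \<circ> inv_into ?E merge) (incident ?Y w)"
      by (rule inj_on_cong[THEN iffD1, rotated]) (simp add: incident_def)
  qed
  show ?thesis
  proof (rule bij_betw_byWitness[where f' = ?H])
    show "\<forall>c\<in>colourings ?Y. ?H (?F c) = c"
    proof
      fix c assume "c \<in> colourings ?Y"
      then have c: "c \<in> edges ?Y \<rightarrow>\<^sub>E {0, 1, 2}" by (simp add: colourings_def)
      show "?H (?F c) = c"
      proof
        fix y show "?H (?F c) y = c y"
          using inv[of y] PiE_arb[OF c, of y] by (cases "y \<in> edges ?Y") auto
      qed
    qed
    show "\<forall>d\<in>cut_colourings X e. ?F (?H d) = d"
    proof
      fix d assume d: "d \<in> cut_colourings X e"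
      then have dE: "d \<in> ?E \<rightarrow>\<^sub>E {0, 1, 2}" by (simp add: cut_colourings_def)
      show "?F (?H d) = d"
      proof
        fix f show "?F (?H d) f = d f"
          using HF[OF d, of f] PiE_arb[OF dE, of f] unfolding restrict_apply[of _ ?E] by presburger
      qed
    qed
  qed (use F H in blast)+
qed

text \<open>The vertex \<open>w\<close> off \<open>e\<close> keeps its degree 3 after the
  subtraction, so it sees all three colours and no class of a decomposition can be empty.\<close>

lemma card_decompositions_subtract:
  assumes f: "f0 \<in> edges X - {e}" "f1 \<in> edges X - {e}"
    and neq: "\<And>d. d \<in> cut_colourings X e \<Longrightarrow> d f0 \<noteq> d f1"
    and w: "w \<notin> ends X e" "card (incident X w) = 3"
  shows "card {P. edge_decomposition3 (subtract_edge X e) P} =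
    card {d \<in> cut_colourings X e. d f0 = 0 \<and> d f1 = 1}"
proof -
  let ?Y = "subtract_edge X e"
  let ?F = "\<lambda>c. restrict (c \<circ> merge) (edges X - {e})"
  note bij = bij_betw_cut_colourings
  have val: "?F c f0 = c (merge f0)" "?F c f1 = c (merge f1)" for c
    using f by auto
  have "card {P. edge_decomposition3 ?Y P} =
    card {c \<in> colourings ?Y. c (merge f0) = 0 \<and> c (merge f1) = 1}"
  proof (rule card_decompositions)
    show "merge f0 \<in> edges ?Y" "merge f1 \<in> edges ?Y" using f merge_image by blast+
    fix c assume c: "c \<in> colourings ?Y"
    then have "?F c \<in> cut_colourings X e" using bij by (auto simp: bij_betw_def)
    from neq[OF this] show "c (merge f0) \<noteq> c (merge f1)" unfolding val .
    have inj: "inj_on c (incident ?Y w)" using c by (simp add: colourings_def)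
    have "c ` edges ?Y \<subseteq> {0, 1, 2}" using c by (simp add: colourings_def PiE_def image_subset_iff_funcset)
    then have sub: "c ` incident ?Y w \<subseteq> {0, 1, 2}"
      using image_mono[OF incident_subset] by (rule order_trans[rotated])
    have "card (incident ?Y w) = 3"
      using w card_image[OF inj_on_merge[OF w(1)]] by (simp add: incident_subtract)
    then have "card (c ` incident ?Y w) = 3" using card_image[OF inj] by simp
    then have "c ` incident ?Y w = {0, 1, 2}" using sub by (intro card_subset_eq) auto
    then show "{0, 1, 2} \<subseteq> c ` edges ?Y" by (auto simp: incident_def)
  qed
  also have "\<dots> = card {d \<in> cut_colourings X e. d f0 = 0 \<and> d f1 = 1}"
  proof (rule bij_betw_same_card)
    show "bij_betw ?F {c \<in> colourings ?Y. c (merge f0) = 0 \<and> c (merge f1) = 1}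
      {d \<in> cut_colourings X e. d f0 = 0 \<and> d f1 = 1}"
    proof (rule bij_betw_subset[OF bij])
      have "d \<in> ?F ` {c \<in> colourings ?Y. c (merge f0) = 0 \<and> c (merge f1) = 1}"
        if d: "d \<in> cut_colourings X e" "d f0 = 0" "d f1 = 1" for d
      proof -
        obtain c where "c \<in> colourings ?Y" "d = ?F c" using bij d(1) by (auto simp: bij_betw_def)
        then show ?thesis using d(2,3) val[of c] by auto
      qed
      moreover have "?F c \<in> cut_colourings X e" if "c \<in> colourings ?Y" for c
        using bij that by (rule bij_betw_apply)
      ultimately show "?F ` {c \<in> colourings ?Y. c (merge f0) = 0 \<and> c (merge f1) = 1} =
        {d \<in> cut_colourings X e. d f0 = 0 \<and> d f1 = 1}"
        using val by (intro equalityI subsetI) auto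
    qed blast
  qed
  finally show ?thesis .
qed

end

section \<open>Kempe chains\<close>

lemma card_2_other:
  assumes "card A = 2" "x \<in> A"
  obtains y where "A = {x, y}" "y \<noteq> x"
  using assms unfolding card_2_iff by blast

text \<open>
  \<open>S\<close> is the trail walked so far and \<open>w\<close> its head. Every vertex outside \<open>T\<close> has degree 0 or 2, so the
  trail can be extended until it hits \<open>T\<close>, and the last edge is its only new contact with \<open>T\<close>.
\<close>

lemma trail_reaches_terminal:
  fixes ends' :: "'e \<Rightarrow> 'v set"
  assumes fin: "finite E"
    and card2: "\<And>f. f \<in> E \<Longrightarrow> card (ends' f) = 2"
    and deg: "\<And>v. v \<notin> T \<Longrightarrow> {f \<in> E. v \<in> ends' f} = {} \<or> card {f \<in> E. v \<in> ends' f} = 2"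
  shows "S \<subseteq> E \<Longrightarrow> w \<notin> T \<Longrightarrow> card {f \<in> S. w \<in> ends' f} = 1 \<Longrightarrow>
    \<forall>v. v \<notin> T \<longrightarrow> v \<noteq> w \<longrightarrow> {f \<in> S. v \<in> ends' f} = {} \<or> {f \<in> E. v \<in> ends' f} \<subseteq> S \<Longrightarrow>
    \<exists>S' f. S \<subseteq> S' \<and> S' \<subseteq> E \<and> f \<notin> S \<and>
      (\<forall>v. v \<notin> T \<longrightarrow> {f \<in> S'. v \<in> ends' f} = {} \<or> {f \<in> E. v \<in> ends' f} \<subseteq> S') \<and>
      {g \<in> S'. ends' g \<inter> T \<noteq> {}} = insert f {g \<in> S. ends' g \<inter> T \<noteq> {}}"
proof (induction "card (E - S)" arbitrary: S w rule: less_induct)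
  case less
  note SE = \<open>S \<subseteq> E\<close> and wT = \<open>w \<notin> T\<close> and closed = less.prems(4)[rule_format]
  obtain g where g: "{f \<in> S. w \<in> ends' f} = {g}"
    using less.prems(3) by (auto simp: card_1_singleton_iff)
  then have gE: "g \<in> {f \<in> E. w \<in> ends' f}" using SE by blast
  then have "card {f \<in> E. w \<in> ends' f} = 2" using deg[OF wT] by blast
  then obtain f where f: "{f \<in> E. w \<in> ends' f} = {g, f}" "f \<noteq> g"
    using gE by (rule card_2_other)
  then have fE: "f \<in> E" "w \<in> ends' f" by blast+
  then have fS: "f \<notin> S" using g f(2) by blast
  obtain w' where w': "ends' f = {w, w'}" "w' \<noteq> w"
    using card2[OF fE(1)] fE(2) by (rule card_2_other)
  let ?S = "insert f S"
  \<comment> \<open>Adding \<open>f\<close> completes the old head \<open>w\<close>, whose two edges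
    are \<open>g\<close> and \<open>f\<close>. Outside the terminals only the new head
    \<open>w'\<close> may remain half used.\<close>
  have closed': "{f \<in> ?S. v \<in> ends' f} = {} \<or> {f \<in> E. v \<in> ends' f} \<subseteq> ?S"
    if v: "v \<notin> T" "v \<noteq> w'" for v
  proof (cases "v = w")
    case True
    have "g \<in> S" using g by blast
    then show ?thesis using f True by simp
  next
    case False
    then have "{f \<in> ?S. v \<in> ends' f} = {f \<in> S. v \<in> ends' f}" using w' v by auto
    then show ?thesis using closed[OF v(1) False] by auto
  qed
  show ?case
  proof (cases "w' \<in> T")
    case True
    then have "{g \<in> ?S. ends' g \<inter> T \<noteq> {}} = insert f {g \<in> S. ends' g \<inter> T \<noteq> {}}"
      using w' by auto
    moreover have "\<forall>v. v \<notin> T \<longrightarrow> {f \<in> ?S. v \<in> ends' f} = {} \<or> {f \<in> E. v \<in> ends' f} \<subseteq> ?S"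
      using closed' True by metis
    ultimately show ?thesis using SE fE fS by (intro exI[of _ ?S] exI[of _ f]) auto
  next
    case False
    \<comment> \<open>The new head is fresh: had the trail met \<open>w'\<close> before, closedness
      would already have put \<open>f\<close> into \<open>S\<close>.\<close>
    have "\<not> {f \<in> E. w' \<in> ends' f} \<subseteq> S" using fE fS w' by auto
    then have "{f \<in> S. w' \<in> ends' f} = {}" using closed[OF False w'(2)] by blast
    then have "{f \<in> ?S. w' \<in> ends' f} = {f}" using w' by auto
    then have one: "card {f \<in> ?S. w' \<in> ends' f} = 1" by simp
    have "E - ?S \<subset> E - S" using fE fS by blast
    then have dec: "card (E - ?S) < card (E - S)" using fin by (simp add: psubset_card_mono)
    have sub: "?S \<subseteq> E" using SE fE by simp
    have at_terminals: "{g \<in> ?S. ends' g \<inter> T \<noteq> {}} = {g \<in> S. ends' g \<inter> T \<noteq> {}}"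
      using w' False wT by auto
    obtain S' f' where S': "?S \<subseteq> S'" "S' \<subseteq> E" "f' \<notin> ?S"
        "\<forall>v. v \<notin> T \<longrightarrow> {f \<in> S'. v \<in> ends' f} = {} \<or> {f \<in> E. v \<in> ends' f} \<subseteq> S'"
        "{g \<in> S'. ends' g \<inter> T \<noteq> {}} = insert f' {g \<in> ?S. ends' g \<inter> T \<noteq> {}}"
      using less.hyps[OF dec sub False one] closed' by blast
    have "S \<subseteq> S'" "f' \<notin> S" using S'(1,3) by auto
    with S'(2,4) S'(5)[unfolded at_terminals] show ?thesis by (intro exI[of _ S'] exI[of _ f'] conjI)
  qed
qed

section \<open>Swapping two colours along Kempe chains\<close>

definition swap_on :: "'e set \<Rightarrow> nat \<Rightarrow> nat \<Rightarrow> ('e \<Rightarrow> nat) \<Rightarrow> 'e \<Rightarrow> nat" where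
  "swap_on S i j d f = (if f \<in> S then if d f = i then j else i else d f)"

text \<open>Either no edge of \<open>A\<close> is swapped, or all edges of \<open>A\<close> with
  colour \<open>i\<close> or \<open>j\<close> are; in the second case a permutation of the colours
  is applied to \<open>A\<close>.\<close>

lemma inj_on_swap_on:
  assumes inj: "inj_on d A" and S: "\<And>f. f \<in> S \<Longrightarrow> d f = i \<or> d f = j"
    and closed: "S \<inter> A = {} \<or> (\<forall>g\<in>A. d g = i \<or> d g = j \<longrightarrow> g \<in> S)"
  shows "inj_on (swap_on S i j d) A"
proof (cases "S \<inter> A = {}")
  case True
  then show ?thesis using inj by (subst inj_on_cong[of _ _ d]) (auto simp: swap_on_def)
next
  case False
  then have "\<forall>g\<in>A. d g = i \<or> d g = j \<longrightarrow> g \<in> S" using closed by blast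
  then show ?thesis using inj S unfolding inj_on_def swap_on_def by metis
qed

context edge_cut
begin

lemma cut_colouring_range: "d \<in> cut_colourings X e \<Longrightarrow> f \<in> edges X \<Longrightarrow> f \<noteq> e \<Longrightarrow> d f \<in> {0, 1, 2}"
  using PiE_mem[of d "edges X - {e}" "\<lambda>_. {0, 1, 2}" f]
  by (simp only: cut_colourings_def mem_Collect_eq Diff_iff) simp

lemma cut_colouring_inj: "d \<in> cut_colourings X e \<Longrightarrow> w \<notin> ends X e \<Longrightarrow> inj_on d (incident X w)"
  by (simp add: cut_colourings_def)

lemma cut_colouring_eq:
  "d \<in> cut_colourings X e \<Longrightarrow> w \<in> ends X e \<Longrightarrow> f \<in> incident X w \<Longrightarrow> f \<noteq> e \<Longrightarrow>
    g \<in> incident X w \<Longrightarrow> g \<noteq> e \<Longrightarrow> d f = d g"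
  unfolding cut_colourings_def by blast

text \<open>For a cut colouring these are the unions of two-coloured chains of the subtracted graph.
  Closure is demanded at the ends of \<open>e\<close> too, where the two remaining edges form one
  merged edge through which the chain passes.\<close>

definition kempe_closed :: "('e \<Rightarrow> nat) \<Rightarrow> nat \<Rightarrow> nat \<Rightarrow> 'e set \<Rightarrow> bool" where
  "kempe_closed d i j S \<longleftrightarrow>
     (\<forall>f\<in>S. f \<in> edges X \<and> f \<noteq> e \<and> (d f = i \<or> d f = j)) \<and>
     (\<forall>w. \<forall>f\<in>S. \<forall>g. f \<in> incident X w \<and> g \<in> incident X w \<and> g \<noteq> e \<and> (d g = i \<or> d g = j) \<longrightarrow> g \<in> S)"

lemma kempe_closedD:
  "kempe_closed d i j S \<Longrightarrow> f \<in> S \<Longrightarrow> f \<in> edges X \<and> f \<noteq> e \<and> (d f = i \<or> d f = j)"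
  unfolding kempe_closed_def by blast

lemma kempe_closed_step:
  "kempe_closed d i j S \<Longrightarrow> f \<in> S \<Longrightarrow> f \<in> incident X w \<Longrightarrow> g \<in> incident X w \<Longrightarrow> g \<noteq> e \<Longrightarrow>
    d g = i \<or> d g = j \<Longrightarrow> g \<in> S"
  unfolding kempe_closed_def by blast

text \<open>The chain through \<open>q\<close> as the least closed set containing it, so no path has
  to be constructed. If \<open>q\<close> is \<open>e\<close>, is no edge, or has another colour, the
  family is empty and the intersection is everything; hence the premises of
  \<open>kempe_closed_kempe\<close>.\<close>

definition kempe :: "('e \<Rightarrow> nat) \<Rightarrow> nat \<Rightarrow> nat \<Rightarrow> 'e \<Rightarrow> 'e set" where
  "kempe d i j q = \<Inter> {S. kempe_closed d i j S \<and> q \<in> S}"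

lemma kempe_closed_cong:
  assumes "\<And>f. (d f = i \<or> d f = j) = (d' f = i \<or> d' f = j)"
  shows "kempe_closed d i j = kempe_closed d' i j"
  by (simp add: kempe_closed_def fun_eq_iff assms)

lemma kempe_closed_kempe:
  assumes "q \<in> edges X" "q \<noteq> e" "d q = i \<or> d q = j"
  shows "kempe_closed d i j (kempe d i j q)" "q \<in> kempe d i j q"
proof -
  have "kempe_closed d i j {f \<in> edges X. f \<noteq> e \<and> (d f = i \<or> d f = j)}"
    by (auto simp: kempe_closed_def incident_def)
  then have "kempe d i j q \<subseteq> {f \<in> edges X. f \<noteq> e \<and> (d f = i \<or> d f = j)}"
    using assms unfolding kempe_def by blast
  moreover have "g \<in> kempe d i j q"
    if "f \<in> kempe d i j q" "f \<in> incident X w" "g \<in> incident X w" "g \<noteq> e" "d g = i \<or> d g = j" for f g w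
    using that unfolding kempe_def kempe_closed_def by blast
  ultimately show "kempe_closed d i j (kempe d i j q)"
    unfolding kempe_closed_def by blast
  show "q \<in> kempe d i j q" by (simp add: kempe_def)
qed

text \<open>Off \<open>e\<close> the swap permutes two colours at each vertex that it touches. At an
  end of \<open>e\<close> the two remaining edges have the same colour, so they are swapped together
  or not at all.\<close>

lemma swap_on_cut_colouring:
  assumes d: "d \<in> cut_colourings X e" and S: "kempe_closed d i j S"
    and ij: "i \<in> {0, 1, 2}" "j \<in> {0, 1, 2}"
  shows "swap_on S i j d \<in> cut_colourings X e"
proof -
  have SE: "f \<in> edges X - {e}" "d f = i \<or> d f = j" if "f \<in> S" for f
    using kempe_closedD[OF S that] by simp_all
  have "swap_on S i j d \<in> (edges X - {e}) \<rightarrow>\<^sub>E {0, 1, 2}"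
  proof (rule PiE_I)
    fix f assume "f \<in> edges X - {e}"
    then show "swap_on S i j d f \<in> {0, 1, 2}"
      using cut_colouring_range[OF d, of f] ij by (simp add: swap_on_def)
  next
    fix f assume "f \<notin> edges X - {e}"
    then show "swap_on S i j d f = undefined"
      using d SE(1)[of f] PiE_arb[of d "edges X - {e}"] by (auto simp: cut_colourings_def swap_on_def)
  qed
  moreover have "inj_on (swap_on S i j d) (incident X w)" if w: "w \<notin> ends X e" for w
  proof (rule inj_on_swap_on[OF cut_colouring_inj[OF d w] SE(2)])
    show "S \<inter> incident X w = {} \<or> (\<forall>g\<in>incident X w. d g = i \<or> d g = j \<longrightarrow> g \<in> S)"
    proof (cases "S \<inter> incident X w = {}")
      case False
      then obtain f where f: "f \<in> S" "f \<in> incident X w" by blast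
      have "g \<noteq> e" if "g \<in> incident X w" for g using that w by (auto simp: incident_def)
      then show ?thesis using kempe_closed_step[OF S f] by simp
    qed simp
  qed
  moreover have "swap_on S i j d f = swap_on S i j d g"
    if w: "w \<in> ends X e" "f \<in> incident X w" "f \<noteq> e" "g \<in> incident X w" "g \<noteq> e" for w f g
  proof -
    have eq: "d f = d g" using cut_colouring_eq[OF d w] .
    have "f \<in> S \<longleftrightarrow> g \<in> S"
    proof
      assume "f \<in> S" then show "g \<in> S" using kempe_closed_step[OF S _ w(2,4,5)] SE(2)[of f] eq by auto
    next
      assume "g \<in> S" then show "f \<in> S" using kempe_closed_step[OF S _ w(4,2,3)] SE(2)[of g] eq by auto
    qed
    then show ?thesis using eq by (simp add: swap_on_def)
  qed
  ultimately show ?thesis unfolding cut_colourings_def by blast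
qed

lemma swap_on_swap_on:
  assumes "kempe_closed d i j S"
  shows "swap_on S i j (swap_on S i j d) = d"
proof
  fix f show "swap_on S i j (swap_on S i j d) f = d f"
    using kempe_closedD[OF assms, of f] by (auto simp: swap_on_def)
qed

text \<open>A swap does not change which edges have one of the two colours, hence it leaves all
  chains in place. This is what makes a Kempe swap its own inverse.\<close>

lemma kempe_swap_on:
  assumes "kempe_closed d i j S"
  shows "kempe (swap_on S i j d) i j q = kempe d i j q"
proof -
  have "kempe_closed (swap_on S i j d) i j = kempe_closed d i j"
    by (rule kempe_closed_cong) (use kempe_closedD[OF assms] in \<open>auto simp: swap_on_def\<close>)
  then show ?thesis by (simp add: kempe_def)
qed

end

section \<open>Kempe chains in a cubic graph that is not 3-edge-colourable\<close>

locale uncolourable_cut = edge_cut +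
  assumes cubic3: "\<And>w. w \<in> verts X \<Longrightarrow> card (incident X w) = 3"
    and ends_verts: "\<And>f. f \<in> edges X \<Longrightarrow> ends X f \<subseteq> verts X"
    and finite_edges: "finite (edges X)"
    and uncolourable: "\<not> edge_colourable3 X"
begin

lemma incident_eq:
  assumes "w \<in> ends X e" "f \<in> incident X w" "g \<in> incident X w" "f \<noteq> e" "g \<noteq> e" "f \<noteq> g"
  shows "incident X w = {e, f, g}"
proof -
  have "w \<in> verts X" using assms(1) ends_verts[OF e_edge] by blast
  then have "card (incident X w) = 3" by (rule cubic3)
  moreover have "e \<in> incident X w" using assms(1) e_edge by (simp add: incident_def)
  moreover have "finite (incident X w)" by (rule finite_subset[OF incident_subset finite_edges])
  ultimately show ?thesis
    using assms by (intro card_seteq[symmetric]) auto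
qed

lemma obtain_other:
  assumes "w \<in> ends X e" "f \<in> incident X w" "f \<noteq> e"
  obtains g where "g \<noteq> f" "g \<noteq> e" "incident X w = {e, f, g}"
proof -
  have "w \<in> verts X" using assms(1) ends_verts[OF e_edge] by blast
  then have 3: "card (incident X w) = 3" by (rule cubic3)
  have "\<not> incident X w \<subseteq> {e, f}"
  proof
    assume "incident X w \<subseteq> {e, f}"
    then have "card (incident X w) \<le> card {e, f}" by (intro card_mono) auto
    then show False using 3 assms by simp
  qed
  then obtain g where "g \<in> incident X w" "g \<noteq> e" "g \<noteq> f" by blast
  then show thesis using that incident_eq assms by metis
qed

text \<open>The three edges at a vertex off \<open>e\<close> show each colour exactly once, so one
  has colour \<open>i\<close> and one has colour \<open>j\<close>. Points outside the graph meet no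
  edge.\<close>

lemma bicoloured_degree:
  assumes d: "d \<in> cut_colourings X e" and ij: "i \<in> {0, 1, 2}" "j \<in> {0, 1, 2}" "i \<noteq> j"
    and w: "w \<notin> ends X e"
  shows "{f \<in> incident X w. d f = i \<or> d f = j} = {} \<or> card {f \<in> incident X w. d f = i \<or> d f = j} = 2"
proof (cases "w \<in> verts X")
  case True
  have inj: "inj_on d (incident X w)" using d w by (rule cut_colouring_inj)
  have "d ` incident X w \<subseteq> {0, 1, 2}"
  proof (rule image_subsetI)
    fix f assume "f \<in> incident X w"
    then have "f \<in> edges X" "f \<noteq> e" using w by (auto simp: incident_def)
    then show "d f \<in> {0, 1, 2}" by (rule cut_colouring_range[OF d])
  qed
  then have img: "d ` incident X w = {0, 1, 2}"
    using cubic3[OF True] card_image[OF inj] by (intro card_subset_eq) auto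
  let ?A = "{f \<in> incident X w. d f = i \<or> d f = j}"
  have "i \<in> d ` incident X w" "j \<in> d ` incident X w" unfolding img by (fact ij)+
  then have "d ` ?A = {i, j}" by auto
  moreover have "inj_on d ?A" using inj by (rule inj_on_subset) blast
  ultimately have "card ?A = 2" using card_image[of d ?A] ij(3) by simp
  then show ?thesis ..
next
  case False
  then have "incident X w = {}" using ends_verts by (auto simp: incident_def)
  then show ?thesis by simp
qed

text \<open>
  Follow the bicoloured path that leaves \<open>q\<close> away from \<open>e\<close>. If it came back along an edge at the
  other end of \<open>e\<close>, then swapping its colours would leave a colour for \<open>e\<close>, a 3-edge-colouring of
  the whole graph.
\<close>

lemma kempe_separates:
  assumes d: "d \<in> cut_colourings X e" and ij: "i \<in> {0, 1, 2}" "j \<in> {0, 1, 2}" "i \<noteq> j"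
    and ab: "ends X e = {a, b}" "a \<noteq> b"
    and p: "p \<in> incident X a" "p \<noteq> e" "d p = i"
    and q: "q \<in> incident X b" "q \<noteq> e" "d q = i \<or> d q = j"
  shows "p \<notin> kempe d i j q"
proof -
  define E where "E = {f \<in> edges X. f \<noteq> e \<and> (d f = i \<or> d f = j)}"
  have E_at: "{f \<in> E. v \<in> ends X f} = {f \<in> incident X v. f \<noteq> e \<and> (d f = i \<or> d f = j)}" for v
    by (auto simp: E_def incident_def)
  have E_at': "{f \<in> E. v \<in> ends X f} = {f \<in> incident X v. d f = i \<or> d f = j}" if "v \<notin> {a, b}" for v
    using that unfolding E_at by (auto simp: incident_def ab)
  have one_end: "f = e" if "f \<in> edges X" "a \<in> ends X f" "b \<in> ends X f" for f
    using edge_eqI[of f e a b] that ab e_edge by simp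
  have qE: "q \<in> E" and bq: "b \<in> ends X q" using q by (auto simp: E_def incident_def)
  have aq: "a \<notin> ends X q" using one_end[of q] qE bq by (auto simp: E_def)
  have "card (ends X q) = 2" using card_ends qE by (simp add: E_def)
  then obtain x where x: "ends X q = {b, x}" "x \<noteq> b" using bq by (rule card_2_other)
  then have xT: "x \<notin> {a, b}" using aq by auto
  \<comment> \<open>The trail starts as \<open>q\<close> alone, with head \<open>x\<close>; the
    terminals are the two ends of \<open>e\<close>.\<close>
  have "\<exists>S f. {q} \<subseteq> S \<and> S \<subseteq> E \<and> f \<notin> {q} \<and>
      (\<forall>v. v \<notin> {a, b} \<longrightarrow> {f \<in> S. v \<in> ends X f} = {} \<or> {f \<in> E. v \<in> ends X f} \<subseteq> S) \<and>
      {g \<in> S. ends X g \<inter> {a, b} \<noteq> {}} = insert f {g \<in> {q}. ends X g \<inter> {a, b} \<noteq> {}}"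
  proof (rule trail_reaches_terminal)
    show "finite E" using finite_edges by (simp add: E_def)
    show "card (ends X f) = 2" if "f \<in> E" for f using that card_ends by (simp add: E_def)
    show "{f \<in> E. v \<in> ends X f} = {} \<or> card {f \<in> E. v \<in> ends X f} = 2" if "v \<notin> {a, b}" for v
      unfolding E_at'[OF that] using bicoloured_degree[OF d ij] that ab by simp
    show "{q} \<subseteq> E" using qE by simp
    show "x \<notin> {a, b}" by (fact xT)
    have "{f \<in> {q}. x \<in> ends X f} = {q}" using x by auto
    then show "card {f \<in> {q}. x \<in> ends X f} = 1" by simp
    show "\<forall>v. v \<notin> {a, b} \<longrightarrow> v \<noteq> x \<longrightarrow> {f \<in> {q}. v \<in> ends X f} = {} \<or> {f \<in> E. v \<in> ends X f} \<subseteq> {q}"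
      using x by auto
  qed
  then obtain S f where S: "q \<in> S" "S \<subseteq> E" "f \<noteq> q"
      and closed: "\<And>v. v \<notin> {a, b} \<Longrightarrow> {f \<in> S. v \<in> ends X f} = {} \<or> {f \<in> E. v \<in> ends X f} \<subseteq> S"
      and at_terminals': "{g \<in> S. ends X g \<inter> {a, b} \<noteq> {}} = insert f {g \<in> {q}. ends X g \<inter> {a, b} \<noteq> {}}"
    by auto
  have "{g \<in> {q}. ends X g \<inter> {a, b} \<noteq> {}} = {q}" using bq by auto
  then have at_terminals: "{g \<in> S. ends X g \<inter> {a, b} \<noteq> {}} = {f, q}" using at_terminals' by simp
  have fS: "f \<in> S" and fT: "a \<in> ends X f \<or> b \<in> ends X f" using at_terminals by blast+
  have fE: "f \<in> edges X" "f \<noteq> e" using fS S by (auto simp: E_def)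
  have at_a: "g \<in> {f, q}" if "g \<in> S" "a \<in> ends X g" for g
    using that unfolding at_terminals[symmetric] by simp
  have at_b: "g \<in> {f, q}" if "g \<in> S" "b \<in> ends X g" for g
    using that unfolding at_terminals[symmetric] by simp
  have SE: "g \<in> edges X" "g \<noteq> e" "d g = i \<or> d g = j" if "g \<in> S" for g
    using that S by (auto simp: E_def)
  have bT: "b \<in> ends X f"
  proof (rule ccontr)
    assume bf: "b \<notin> ends X f"
    then have af: "a \<in> ends X f" using fT by simp
    have "\<exists>k\<in>{0, 1, 2}. k \<noteq> i \<and> k \<noteq> j"
      by (cases "i = 0 \<or> j = 0"; cases "i = 1 \<or> j = 1") (use ij(3) in auto)
    then obtain k where k: "k \<in> {0, 1, 2}" "k \<noteq> i" "k \<noteq> j" by (elim bexE conjE)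
    \<comment> \<open>Along a trail from \<open>b\<close> to \<open>a\<close> the swap changes
      exactly one of the two equally coloured edges at each end of \<open>e\<close>. Both ends then
      show \<open>i\<close> and \<open>j\<close>, which leaves the third colour \<open>k\<close> for
      \<open>e\<close>.\<close>
    define d' where "d' = (swap_on S i j d)(e := k)"
    have "edge_colouring3 X d'"
      unfolding edge_colouring3_iff
    proof (intro conjI allI image_subsetI)
      fix g assume "g \<in> edges X"
      then show "d' g \<in> {0, 1, 2}"
        using k(1) ij(1,2) cut_colouring_range[OF d, of g] by (simp add: d'_def swap_on_def)
    next
      fix v
      consider "v \<notin> {a, b}" | "v = a" | "v = b" by blast
      then show "inj_on d' (incident X v)"
      proof cases
        case 1
        have "inj_on (swap_on S i j d) (incident X v)"
        proof (rule inj_on_swap_on)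
          show "inj_on d (incident X v)" using 1 ab by (intro cut_colouring_inj[OF d]) simp
          show "d g = i \<or> d g = j" if "g \<in> S" for g using SE that by simp
          have "S \<inter> incident X v = {g \<in> S. v \<in> ends X g}" using SE by (auto simp: incident_def)
          then show "S \<inter> incident X v = {} \<or> (\<forall>g\<in>incident X v. d g = i \<or> d g = j \<longrightarrow> g \<in> S)"
            using closed[OF 1] E_at'[OF 1] by auto
        qed
        moreover have "e \<notin> incident X v" using 1 ab by (simp add: incident_def)
        ultimately show ?thesis by (subst inj_on_cong[of _ _ "swap_on S i j d"]) (auto simp: d'_def)
      next
        case 2
        have "f \<in> incident X a" using af fE by (simp add: incident_def)
        then obtain g where g: "g \<noteq> f" "g \<noteq> e" "incident X a = {e, f, g}"
          using obtain_other[of a f] fE ab by auto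
        have "g \<notin> S" using at_a[of g] g aq by (auto simp: incident_def)
        moreover have "d f = i" "d g = i"
          using cut_colouring_eq[OF d, of a _ p] p g fE ab by auto
        ultimately show ?thesis
          using g fE fS k ij(3) by (simp add: 2 d'_def swap_on_def)
      next
        case 3
        obtain g where g: "g \<noteq> q" "g \<noteq> e" "incident X b = {e, q, g}"
          using obtain_other[of b q] q ab by auto
        have "g \<notin> S" using at_b[of g] g bf by (auto simp: incident_def)
        moreover have "d g = d q"
          by (rule cut_colouring_eq[OF d, of b]) (simp_all add: ab g q)
        moreover have "inj_on d' {e, q, g}" if "d' e \<noteq> d' q" "d' e \<noteq> d' g" "d' q \<noteq> d' g"
          using that by auto
        ultimately show ?thesis
          using S(1) q(2,3) g k(2,3) ij(3) unfolding 3 g(3) d'_def swap_on_def by (elim disjE) simp_all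
      qed
    qed
    then show False using uncolourable by (auto simp: edge_colourable3_def)
  qed
  \<comment> \<open>So the trail returns to \<open>b\<close>. It then contains both edges at
    \<open>b\<close> other than \<open>e\<close> and avoids \<open>a\<close>, which makes it a
    closed set containing \<open>q\<close> but not \<open>p\<close>.\<close>
  have af: "a \<notin> ends X f" using one_end[of f] fE bT by auto
  have not_a: "a \<notin> ends X g" if "g \<in> S" for g using at_a[OF that] af aq by auto
  have inc_b: "incident X b = {e, q, f}"
    using incident_eq[of b q f] q fE bT S ab by (auto simp: incident_def)
  have "kempe_closed d i j S"
    unfolding kempe_closed_def
  proof (intro conjI ballI allI impI)
    fix v g h assume g: "g \<in> S"
      and h: "g \<in> incident X v \<and> h \<in> incident X v \<and> h \<noteq> e \<and> (d h = i \<or> d h = j)"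
    show "h \<in> S"
    proof (cases "v \<in> {a, b}")
      case True
      then have "v = b" using not_a[OF g] h by (auto simp: incident_def)
      then show ?thesis using h inc_b S fS by auto
    next
      case False
      have "g \<in> {f \<in> S. v \<in> ends X f}" using g h by (simp add: incident_def)
      then have "{f \<in> E. v \<in> ends X f} \<subseteq> S" using closed[OF False] by blast
      then show ?thesis using h E_at by blast
    qed
  qed (use SE in auto)
  moreover have "p \<notin> S" using not_a p by (auto simp: incident_def)
  ultimately show ?thesis using S(1) by (auto simp: kempe_def)
qed

text \<open>Split the colourings by the colour of an edge \<open>q\<close> at the end
  \<open>b\<close>. Since \<open>f0\<close> and \<open>f1\<close> have colours 0 and 1, the edge
  \<open>p\<close> from \<open>w\<close> to \<open>a\<close> has colour 2. Swapping 2 with 0 or 1 on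
  the chain through \<open>q\<close> avoids \<open>p\<close>, hence fixes all colours at
  \<open>w\<close>, and shows that the three parts have equal size.\<close>

lemma three_dvd_cut_colourings:
  assumes ab: "ends X e = {a, b}" "a \<noteq> b"
    and w: "w \<notin> ends X e" "incident X w = {f0, f1, p}" "distinct [f0, f1, p]"
    and p: "a \<in> ends X p"
  shows "3 dvd card {d \<in> cut_colourings X e. d f0 = 0 \<and> d f1 = 1}"
proof -
  define M where "M k q = {d \<in> cut_colourings X e. d f0 = 0 \<and> d f1 = 1 \<and> d q = k}" for k q
  have finM: "finite (M k q)" for k q
  proof (rule finite_subset)
    show "M k q \<subseteq> (edges X - {e}) \<rightarrow>\<^sub>E {0, 1, 2}" unfolding M_def cut_colourings_def by blast
    show "finite ((edges X - {e}) \<rightarrow>\<^sub>E {0, 1, 2 :: nat})" using finite_edges by (intro finite_PiE) auto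
  qed
  have in_w: "f0 \<in> incident X w" "f1 \<in> incident X w" "p \<in> incident X w" using w by auto
  then have ne: "f0 \<noteq> e" "f1 \<noteq> e" "p \<noteq> e" "p \<in> edges X" using w(1) by (auto simp: incident_def)
  have pa: "p \<in> incident X a" using ne p by (simp add: incident_def)
  have "b \<in> ends X e" by (simp add: ab)
  moreover have "e \<in> incident X b" using ab e_edge by (simp add: incident_def)
  ultimately obtain q where q: "q \<in> incident X b" "q \<noteq> e" using other_edge[of b] by blast
  then have qX: "q \<in> edges X" by (simp add: incident_def)
  have dp: "d p = 2" if "d \<in> M k q" for d k
  proof -
    have d: "d \<in> cut_colourings X e" "d f0 = 0" "d f1 = 1" using that by (auto simp: M_def)
    have "inj_on d (incident X w)" using d(1) w(1) by (rule cut_colouring_inj)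
    then have "d p \<noteq> d f0" "d p \<noteq> d f1" using w by auto
    then show ?thesis using d cut_colouring_range[OF d(1) ne(4) ne(3)] by simp
  qed
  let ?s = "\<lambda>j d. swap_on (kempe d 2 j q) 2 j d"
  have swap: "?s j d \<in> M l q" "?s j (?s j d) = d"
    \<comment> \<open>Both directions are treated at once, from colour \<open>j\<close> to 2 and
      back, so that the swap serves as its own inverse below.\<close>
    if d: "d \<in> M k q" and j: "j \<in> {0, 1}" and kl: "(k, l) \<in> {(2, j), (j, 2)}" for d j k l
  proof -
    have dc: "d \<in> cut_colourings X e" and d01: "d f0 = 0" "d f1 = 1" "d q = k" using d by (auto simp: M_def)
    have j': "j \<in> {0, 1, 2}" "2 \<noteq> j" using j by auto
    have dq: "d q = 2 \<or> d q = j" using d01 kl by auto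
    note K = kempe_closed_kempe[where d = d and i = 2 and j = j, OF qX q(2) dq]
    have pK: "p \<notin> kempe d 2 j q"
      by (rule kempe_separates[OF dc _ j' ab pa ne(3) dp[OF d] q dq]) simp
    \<comment> \<open>A chain that reaches \<open>w\<close> would continue into \<open>p\<close>,
      because \<open>p\<close> has colour 2, one of the two swapped colours.\<close>
    have no: "g \<notin> kempe d 2 j q" if "g \<in> incident X w" for g
    proof
      assume "g \<in> kempe d 2 j q"
      moreover have "d p = 2 \<or> d p = j" using dp[OF d] by simp
      ultimately have "p \<in> kempe d 2 j q"
        using K(1) that in_w(3) ne(3) unfolding kempe_closed_def by blast
      then show False using pK by simp
    qed
    have "?s j d \<in> cut_colourings X e"
      by (rule swap_on_cut_colouring[OF dc K(1)]) (use j' in auto)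
    moreover have "?s j d q = l" using K(2) d01 kl j' by (auto simp: swap_on_def)
    moreover have "?s j d f0 = 0" "?s j d f1 = 1"
      using no[OF in_w(1)] no[OF in_w(2)] d01 by (simp_all add: swap_on_def)
    ultimately show "?s j d \<in> M l q" by (simp add: M_def)
    show "?s j (?s j d) = d" using kempe_swap_on[OF K(1)] swap_on_swap_on[OF K(1)] by simp
  qed
  have card_eq: "card (M j q) = card (M 2 q)" if j: "j \<in> {0, 1}" for j
  proof (rule bij_betw_same_card)
    show "bij_betw (?s j) (M j q) (M 2 q)"
      by (rule bij_betw_byWitness[where f' = "?s j"])
        (use swap(1)[of _ j j 2] swap(2)[of _ j j 2] swap(1)[of _ 2 j j] swap(2)[of _ 2 j j] j
          in \<open>simp_all add: image_subset_iff\<close>)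
  qed
  have "d \<in> M 0 q \<union> M 1 q \<union> M 2 q" if "d \<in> cut_colourings X e" "d f0 = 0" "d f1 = 1" for d
    using that cut_colouring_range[OF that(1) qX q(2)] unfolding M_def by simp
  then have "{d \<in> cut_colourings X e. d f0 = 0 \<and> d f1 = 1} = M 0 q \<union> M 1 q \<union> M 2 q"
    by (intro equalityI subsetI) (simp_all add: M_def, blast)
  moreover have "card (M 0 q \<union> M 1 q \<union> M 2 q) = card (M 0 q) + card (M 1 q) + card (M 2 q)"
    by (subst card_Un_disjoint, use finM in \<open>auto simp: M_def\<close>)+
  ultimately have "card {d \<in> cut_colourings X e. d f0 = 0 \<and> d f1 = 1} = 3 * card (M 2 q)"
    using card_eq[of 0] card_eq[of 1] by simp
  then show ?thesis by simp
qed

end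

section \<open>Colourings of the gadget\<close>

text \<open>
  The edges of \<open>T\<close>, together with one loop for each link that survives the subtraction of the link
  at \<open>Tc\<close>. The order keeps the search tree of \<open>port_colours\<close> small.
\<close>

definition gadget_edges :: "(tvert \<times> tvert) list" where
  "gadget_edges = [(Tc, Ti), (Th, Tc), (Th, Ts2), (Tb, Th), (Tb, Tb), (Tb, Ts1), (Ts1, Ts4), (Tg, Ts1),
     (Ts4, Ts2), (Ts2, Ts3), (Tf, Ts4), (Ts3, Tg), (Ta, Ts3), (Tg, Tj), (Ta, Tf), (Ta, Ta), (Tf, Tk),
     (Ti, Td), (Ti, Tt1), (Td, Td), (Td, Tt2), (Tt2, Tj), (Tt4, Tt2), (Tj, Tt3), (Tt1, Tt4),
     (Tt3, Tt1), (Tk, Tt4), (Tk, Te), (Te, Tt3), (Te, Te)]"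

text \<open>This order of the ports is the order of the entries in the tuples returned by
  \<open>port_colours\<close>.\<close>

definition gadget_ports :: "(tvert \<times> tvert) list" where
  "gadget_ports = [(Ta, Ta), (Tb, Tb), (Td, Td), (Te, Te)]"

text \<open>
  Conditionals instead of connectives, because \<open>code_simp\<close> evaluates only the branch taken.
\<close>

definition meet :: "tvert \<times> tvert \<Rightarrow> tvert \<times> tvert \<Rightarrow> bool" where
  "meet f g = (if fst f = fst g then True else if fst f = snd g then True
     else if snd f = fst g then True else snd f = snd g)"

text \<open>The two edges at \<open>Tc\<close> merge into one, so they are required to have equal colours.\<close>

definition compat :: "tvert \<times> tvert \<Rightarrow> nat \<Rightarrow> tvert \<times> tvert \<Rightarrow> nat \<Rightarrow> bool" where
  "compat f k g l =
     (if meet f g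
      then if meet f (Tc, Tc) then if meet g (Tc, Tc) then k = l else k \<noteq> l else k \<noteq> l
      else True)"

fun all_compat :: "tvert \<times> tvert \<Rightarrow> nat \<Rightarrow> ((tvert \<times> tvert) \<times> nat) list \<Rightarrow> bool" where
  "all_compat f k [] = True"
| "all_compat f k ((g, l) # ps) = (if compat f k g l then all_compat f k ps else False)"

text \<open>Backtracking search with partial colouring \<open>ps\<close> and uncoloured edges
  \<open>fs\<close>. Each full colouring contributes its port tuple once, so multiplicities in the
  result count colourings.\<close>

fun port_colours :: "((tvert \<times> tvert) \<times> nat) list \<Rightarrow> (tvert \<times> tvert) list \<Rightarrow> nat list list" where
  "port_colours ps [] = [map (the \<circ> map_of ps) gadget_ports]"
| "port_colours ps (f # fs) =
     (if all_compat f 0 ps then port_colours ((f, 0) # ps) fs else [])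
   @ (if all_compat f 1 ps then port_colours ((f, 1) # ps) fs else [])
   @ (if all_compat f 2 ps then port_colours ((f, 2) # ps) fs else [])"

text \<open>With \<open>i\<close>, \<open>j\<close>, \<open>k\<close>, \<open>l\<close> at
  \<open>Ta\<close>, \<open>Tb\<close>, \<open>Td\<close>, \<open>Te\<close>, the nonzero cases are
  the boundary patterns of a single edge whose ends carry the ports \<open>Ta\<close>,
  \<open>Tb\<close> and \<open>Td\<close>, \<open>Te\<close>.\<close>

definition seven_each :: "nat list list \<Rightarrow> bool" where
  "seven_each xs \<longleftrightarrow> (\<forall>i\<in>{0, 1, 2}. \<forall>j\<in>{0, 1, 2}. \<forall>k\<in>{0, 1, 2}. \<forall>l\<in>{0, 1, 2}.
     count_list xs [i, j, k, l] =
       (if i = j then 0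
        else if k = i then if l = j then 7 else 0
        else if k = j then if l = i then 7 else 0
        else 0))"

text \<open>The finite computation from which the factor 7 comes.\<close>

lemma seven_each_port_colours: "seven_each (port_colours [] gadget_edges)"
  by code_simp

section \<open>Correctness of the exhaustive search\<close>

lemma meet_iff: "meet f g \<longleftrightarrow> fst f = fst g \<or> fst f = snd g \<or> snd f = fst g \<or> snd f = snd g"
  by (simp add: meet_def)

text \<open>What a node of the search tree counts. Only pairs with an edge in \<open>fs\<close> are
  tested, because pairs inside \<open>ps\<close> were tested when \<open>ps\<close> was built; with
  \<open>fs\<close> empty exactly one completion is left.\<close>

definition completions ::
  "((tvert \<times> tvert) \<times> nat) list \<Rightarrow> (tvert \<times> tvert) list \<Rightarrow> (tvert \<times> tvert \<Rightarrow> nat) set" where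
  "completions ps fs = {c. (\<forall>x. x \<notin> fst ` set ps \<union> set fs \<longrightarrow> c x = undefined) \<and>
     (\<forall>(g, l)\<in>set ps. c g = l) \<and> (\<forall>f\<in>set fs. c f \<in> {0, 1, 2}) \<and>
     (\<forall>f\<in>set fs. \<forall>g\<in>fst ` set ps \<union> set fs. f \<noteq> g \<longrightarrow> compat f (c f) g (c g))}"

lemma all_compat_iff: "all_compat f k ps \<longleftrightarrow> (\<forall>(g, l)\<in>set ps. compat f k g l)"
  by (induction f k ps rule: all_compat.induct) auto

lemma compat_sym: "compat f k g l \<longleftrightarrow> compat g l f k"
  unfolding compat_def meet_def by (auto split: if_splits)

text \<open>Fixing the colour of \<open>f\<close> is one branching step. The test of
  \<open>f\<close> against \<open>ps\<close> is made now; its tests against \<open>fs\<close>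
  reappear, by symmetry of \<open>compat\<close>, as tests of the later edges.\<close>

lemma completions_Cons:
  assumes "f \<notin> fst ` set ps" "f \<notin> set fs"
  shows "c \<in> completions ps (f # fs) \<longleftrightarrow>
    c f \<in> {0, 1, 2} \<and> all_compat f (c f) ps \<and> c \<in> completions ((f, c f) # ps) fs"
proof -
  let ?D = "fst ` set ps \<union> set (f # fs)"
  have D: "fst ` set ((f, c f) # ps) \<union> set fs = ?D" by auto
  have ps: "(\<forall>(g, l)\<in>set ((f, c f) # ps). c g = l) \<longleftrightarrow> (\<forall>(g, l)\<in>set ps. c g = l)" by simp
  have "(\<forall>g\<in>set (f # fs). \<forall>h\<in>?D. g \<noteq> h \<longrightarrow> compat g (c g) h (c h)) \<longleftrightarrow>
      all_compat f (c f) ps \<and> (\<forall>g\<in>set fs. \<forall>h\<in>?D. g \<noteq> h \<longrightarrow> compat g (c g) h (c h))"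
    if eq: "\<forall>(g, l)\<in>set ps. c g = l"
  proof -
    have "all_compat f (c f) ps \<longleftrightarrow> (\<forall>h\<in>fst ` set ps. compat f (c f) h (c h))"
      using eq unfolding all_compat_iff by force
    moreover have "compat f (c f) h (c h)" if "\<forall>g\<in>set fs. \<forall>h\<in>?D. g \<noteq> h \<longrightarrow> compat g (c g) h (c h)" "h \<in> set fs" for h
    proof -
      have "h \<noteq> f" using that assms by blast
      then have "compat h (c h) f (c f)" using that by simp
      then show ?thesis by (simp only: compat_sym)
    qed
    ultimately show ?thesis using assms by auto
  qed
  moreover have "(\<forall>g\<in>set (f # fs). c g \<in> {0, 1, 2}) \<longleftrightarrow> c f \<in> {0, 1, 2} \<and> (\<forall>g\<in>set fs. c g \<in> {0, 1, 2})"
    by (simp only: list.set ball_simps)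
  ultimately show ?thesis unfolding completions_def mem_Collect_eq D ps by argo
qed

text \<open>Induction along the search: a leaf has one completion, and the branches at
  \<open>f\<close> are disjoint because they differ in the colour of \<open>f\<close>. The condition
  on the ports ensures that every leaf knows all port colours.\<close>

lemma card_completions:
  "distinct (map fst ps @ fs) \<Longrightarrow> set gadget_ports \<subseteq> fst ` set ps \<union> set fs \<Longrightarrow>
    finite (completions ps fs) \<and>
    card {c \<in> completions ps fs. map c gadget_ports = t} = count_list (port_colours ps fs) t"
proof (induction fs arbitrary: ps)
  case Nil
  define c where "c x = (if x \<in> fst ` set ps then the (map_of ps x) else undefined)" for x
  have map_of: "map_of ps g = Some l" if "(g, l) \<in> set ps" for g l
    using Nil that by (simp add: map_of_is_SomeI)
  have "d \<in> completions ps [] \<longleftrightarrow> d = c" for d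
  proof
    assume d: "d \<in> completions ps []"
    show "d = c"
    proof
      fix x show "d x = c x"
      proof (cases "x \<in> fst ` set ps")
        case True
        then obtain l where "(x, l) \<in> set ps" by auto
        then show ?thesis using d map_of[of x l] True by (auto simp: completions_def c_def)
      next
        case False
        then have "d x = undefined" using d by (cases x) (simp add: completions_def)
        then show ?thesis using False by (simp add: c_def)
      qed
    qed
  next
    assume "d = c"
    then show "d \<in> completions ps []"
      using map_of by (force simp: completions_def c_def)
  qed
  then have "completions ps [] = {c}" by blast
  moreover have "map (the \<circ> map_of ps) gadget_ports = map c gadget_ports"
    using Nil(2) by (auto simp: c_def)
  then have "count_list (port_colours ps []) t = (if map c gadget_ports = t then 1 else 0)"
    by (simp only: port_colours.simps count_list.simps add_0)
  moreover have "{d. d = c \<and> map d gadget_ports = t} = (if map c gadget_ports = t then {c} else {})"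
    by auto
  ultimately show ?case by (simp del: port_colours.simps)
next
  case (Cons f fs)
  define N where "N k = (if all_compat f k ps then completions ((f, k) # ps) fs else {})" for k
  have f: "f \<notin> fst ` set ps" "f \<notin> set fs" using Cons.prems by auto
  have dist: "distinct (map fst ((f, k) # ps) @ fs)"
    "set gadget_ports \<subseteq> fst ` set ((f, k) # ps) \<union> set fs" for k
    using Cons.prems by auto
  have Nf: "c f = k" if "c \<in> N k" for c k
    using that by (simp add: N_def completions_def split: if_splits)
  have fin: "finite (N k)" for k
    using Cons.IH[OF dist] by (simp add: N_def)
  have "c \<in> completions ps (f # fs) \<longleftrightarrow> c \<in> N 0 \<union> N 1 \<union> N 2" for c
  proof
    assume "c \<in> completions ps (f # fs)"
    then have "c f \<in> {0, 1, 2}" "c \<in> N (c f)"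
      unfolding completions_Cons[OF f] by (simp_all add: N_def)
    then show "c \<in> N 0 \<union> N 1 \<union> N 2" by (elim insertE emptyE) simp_all
  next
    assume "c \<in> N 0 \<union> N 1 \<union> N 2"
    then have "\<exists>k\<in>{0, 1, 2}. c \<in> N k" by simp
    then obtain k where k: "k \<in> {0, 1, 2}" "c \<in> N k" by (elim bexE)
    then have "c f = k" using Nf by simp
    then show "c \<in> completions ps (f # fs)"
      using k unfolding completions_Cons[OF f] by (auto simp: N_def split: if_splits)
  qed
  then have un: "completions ps (f # fs) = N 0 \<union> N 1 \<union> N 2" by blast
  define M where "M k = {c \<in> N k. map c gadget_ports = t}" for k
  have "card (M k) = count_list (if all_compat f k ps then port_colours ((f, k) # ps) fs else []) t" for k
    using Cons.IH[OF dist] by (simp add: M_def N_def)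
  moreover have "{c \<in> completions ps (f # fs). map c gadget_ports = t} = M 0 \<union> M 1 \<union> M 2"
    unfolding un M_def by blast
  moreover have "card (M 0 \<union> M 1 \<union> M 2) = card (M 0) + card (M 1) + card (M 2)"
  proof -
    have finM: "finite (M k)" for k using fin by (simp add: M_def)
    have disj: "M k \<inter> M l = {}" if "k \<noteq> l" for k l
    proof (rule ccontr)
      assume "M k \<inter> M l \<noteq> {}"
      then obtain c where "c \<in> N k" "c \<in> N l" unfolding M_def by blast
      then show False using Nf that by metis
    qed
    show ?thesis using finM disj by (simp add: card_Un_disjoint Int_Un_distrib2)
  qed
  moreover have "finite (completions ps (f # fs))" unfolding un using fin by simp
  ultimately show ?case by simp
qed

text \<open>The same constraints vertex by vertex, in the shape in which a cut colouring of the
  superposition restricts to the gadget.\<close>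

definition gadget_colourings :: "(tvert \<times> tvert \<Rightarrow> nat) set" where
  "gadget_colourings = {c \<in> set gadget_edges \<rightarrow>\<^sub>E {0, 1, 2}.
     (\<forall>t. t \<noteq> Tc \<longrightarrow> inj_on c {f \<in> set gadget_edges. t = fst f \<or> t = snd f}) \<and> c (Th, Tc) = c (Tc, Ti)}"

lemma gadget_edges_at_c:
  "{f \<in> set gadget_edges. Tc = fst f \<or> Tc = snd f} = {(Tc, Ti), (Th, Tc)}"
  unfolding set_filter[symmetric] gadget_edges_def by simp

text \<open>Pairwise tests agree with injectivity at vertices because the only two edges at
  \<open>Tc\<close> have no further vertex in common; the exception made at \<open>Tc\<close> thus
  affects no other vertex.\<close>

lemma completions_gadget_edges: "completions [] gadget_edges = gadget_colourings"
proof -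
  let ?G = "set gadget_edges"
  have at_c: "f = (Th, Tc) \<or> f = (Tc, Ti)" if "f \<in> ?G" "meet f (Tc, Tc)" for f
  proof -
    have "f \<in> {f \<in> ?G. Tc = fst f \<or> Tc = snd f}" using that by (auto simp: meet_iff)
    then show ?thesis unfolding gadget_edges_at_c by blast
  qed
  have G: "(Th, Tc) \<in> ?G" "(Tc, Ti) \<in> ?G" by (simp_all add: gadget_edges_def)
  have "(\<forall>f\<in>?G. \<forall>g\<in>?G. f \<noteq> g \<longrightarrow> compat f (c f) g (c g)) \<longleftrightarrow>
      (\<forall>t. t \<noteq> Tc \<longrightarrow> inj_on c {f \<in> ?G. t = fst f \<or> t = snd f}) \<and> c (Th, Tc) = c (Tc, Ti)" for c
  proof (intro iffI conjI allI impI ballI)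
    assume *: "\<forall>f\<in>?G. \<forall>g\<in>?G. f \<noteq> g \<longrightarrow> compat f (c f) g (c g)"
    have "compat (Th, Tc) (c (Th, Tc)) (Tc, Ti) (c (Tc, Ti))" using * G by blast
    then show "c (Th, Tc) = c (Tc, Ti)" by (simp add: compat_def meet_def)
    fix t assume t: "t \<noteq> Tc"
    show "inj_on c {f \<in> ?G. t = fst f \<or> t = snd f}"
    proof (rule inj_onI, rule ccontr)
      fix f g assume f: "f \<in> {f \<in> ?G. t = fst f \<or> t = snd f}" and g: "g \<in> {f \<in> ?G. t = fst f \<or> t = snd f}"
        and eq: "c f = c g" "f \<noteq> g"
      have "meet f g" using f g by (auto simp: meet_iff)
      moreover have "compat f (c f) g (c g)" using * f g eq by blast
      ultimately have "meet f (Tc, Tc)" "meet g (Tc, Tc)" using eq(1) by (auto simp: compat_def split: if_splits)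
      then show False using at_c[of f] at_c[of g] f g eq(2) t by auto
    qed
  next
    fix f g assume *: "(\<forall>t. t \<noteq> Tc \<longrightarrow> inj_on c {f \<in> ?G. t = fst f \<or> t = snd f}) \<and> c (Th, Tc) = c (Tc, Ti)"
      and f: "f \<in> ?G" and g: "g \<in> ?G" and fg: "f \<noteq> g"
    show "compat f (c f) g (c g)"
    proof (cases "meet f (Tc, Tc) \<and> meet g (Tc, Tc)")
      case True
      then have "c f = c g" using at_c[of f] at_c[of g] f g fg * by auto
      then show ?thesis using True by (simp add: compat_def)
    next
      case False
      have "c f \<noteq> c g" if m: "meet f g"
      proof -
        obtain t where t: "t = fst f \<or> t = snd f" "t = fst g \<or> t = snd g"
          using m unfolding meet_iff by blast
        then have "t \<noteq> Tc" using False by (auto simp: meet_iff)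
        then have "inj_on c {f \<in> ?G. t = fst f \<or> t = snd f}" using * by blast
        then show ?thesis using t f g fg by (auto dest: inj_onD)
      qed
      then show ?thesis using False by (auto simp: compat_def)
    qed
  qed
  moreover have "c \<in> ?G \<rightarrow>\<^sub>E {0, 1, 2} \<longleftrightarrow> (\<forall>x. x \<notin> ?G \<longrightarrow> c x = undefined) \<and> (\<forall>f\<in>?G. c f \<in> {0, 1, 2})"
    for c :: "tvert \<times> tvert \<Rightarrow> nat"
    by (simp only: PiE_iff extensional_def mem_Collect_eq conj_commute)
  ultimately show ?thesis
    by (simp only: completions_def gadget_colourings_def list.set image_empty Un_empty_left ball_empty
        simp_thms conj_assoc)
qed

lemma finite_gadget_colourings: "finite gadget_colourings"
proof (rule finite_subset)
  show "gadget_colourings \<subseteq> set gadget_edges \<rightarrow>\<^sub>E {0, 1, 2}" unfolding gadget_colourings_def by blast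
  show "finite (set gadget_edges \<rightarrow>\<^sub>E {0, 1, 2 :: nat})" by (intro finite_PiE) simp_all
qed

lemma card_gadget_colourings:
  assumes "i \<in> {0, 1, 2}" "j \<in> {0, 1, 2}" "k \<in> {0, 1, 2}" "l \<in> {0, 1, 2}"
  shows "card {c \<in> gadget_colourings. c (Ta, Ta) = i \<and> c (Tb, Tb) = j \<and> c (Td, Td) = k \<and> c (Te, Te) = l} =
    (if i \<noteq> j \<and> (k = i \<and> l = j \<or> k = j \<and> l = i) then 7 else 0)"
proof -
  have "distinct (map fst [] @ gadget_edges)" by (simp add: gadget_edges_def)
  moreover have "set gadget_ports \<subseteq> fst ` set [] \<union> set gadget_edges"
    by (simp add: gadget_edges_def gadget_ports_def)
  ultimately have "card {c \<in> gadget_colourings. map c gadget_ports = [i, j, k, l]} =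
      count_list (port_colours [] gadget_edges) [i, j, k, l]"
    by (rule card_completions[of "[]" gadget_edges "[i, j, k, l]", unfolded completions_gadget_edges, THEN conjunct2])
  also have "\<dots> = (if i = j then 0 else if k = i then if l = j then 7 else 0
      else if k = j then if l = i then 7 else 0 else 0)"
    using seven_each_port_colours[unfolded seven_each_def, THEN bspec, OF assms(1), THEN bspec, OF assms(2),
        THEN bspec, OF assms(3), THEN bspec, OF assms(4)] .
  finally show ?thesis by (auto simp: gadget_ports_def)
qed

text \<open>The colourings with the same port colours as \<open>c\<close> include \<open>c\<close>
  itself, so their number is not 0 and the table leaves only these patterns.\<close>

lemma gadget_port_colours:
  assumes c: "c \<in> gadget_colourings"
  shows "c (Ta, Ta) \<noteq> c (Tb, Tb)"
    "c (Td, Td) = c (Ta, Ta) \<and> c (Te, Te) = c (Tb, Tb) \<or> c (Td, Td) = c (Tb, Tb) \<and> c (Te, Te) = c (Ta, Ta)"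
proof -
  have range: "c f \<in> {0, 1, 2}" if "f \<in> set gadget_edges" for f
    using c that unfolding gadget_colourings_def by (blast dest: PiE_mem)
  let ?S = "{d \<in> gadget_colourings. d (Ta, Ta) = c (Ta, Ta) \<and> d (Tb, Tb) = c (Tb, Tb) \<and>
      d (Td, Td) = c (Td, Td) \<and> d (Te, Te) = c (Te, Te)}"
  have "c \<in> ?S" "finite ?S" using c finite_gadget_colourings by simp_all
  then have "card ?S \<noteq> 0" by auto
  moreover have "card ?S = (if c (Ta, Ta) \<noteq> c (Tb, Tb) \<and>
      (c (Td, Td) = c (Ta, Ta) \<and> c (Te, Te) = c (Tb, Tb) \<or>
       c (Td, Td) = c (Tb, Tb) \<and> c (Te, Te) = c (Ta, Ta)) then 7 else 0)"
    by (rule card_gadget_colourings; rule range) (simp_all add: gadget_edges_def)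
  ultimately show "c (Ta, Ta) \<noteq> c (Tb, Tb)"
    "c (Td, Td) = c (Ta, Ta) \<and> c (Te, Te) = c (Tb, Tb) \<or> c (Td, Td) = c (Tb, Tb) \<and> c (Te, Te) = c (Ta, Ta)"
    by (auto split: if_splits)
qed

section \<open>The superposition\<close>

locale superposed_path = uncolourable_cut G0 \<epsilon>
  for G0 :: "('v, 'e) graph" and \<epsilon> :: 'e +
  fixes u1 u2 u3 u4 u5 v2 v3 v4 :: 'v and e12 e23 e34 e45 e2 e4 :: 'e
  assumes distinct_u: "distinct [u1, u2, u3, u4, u5]"
    and v_not_u: "{v2, v3, v4} \<inter> {u1, u2, u3, u4, u5} = {}"
    and joins_path: "joins G0 e12 u1 u2" "joins G0 e23 u2 u3" "joins G0 e34 u3 u4" "joins G0 e45 u4 u5"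
    and joins_v: "joins G0 e2 u2 v2" "joins G0 \<epsilon> u3 v3" "joins G0 e4 u4 v4"
begin

lemma ends_path [simp]:
  "ends G0 e12 = {u1, u2}" "ends G0 e23 = {u2, u3}" "ends G0 e34 = {u3, u4}" "ends G0 e45 = {u4, u5}"
  "ends G0 e2 = {u2, v2}" "ends G0 \<epsilon> = {u3, v3}" "ends G0 e4 = {u4, v4}"
  using joins_path joins_v by (simp_all add: joins_def)

lemma edges_path [simp]:
  "e12 \<in> edges G0" "e23 \<in> edges G0" "e34 \<in> edges G0" "e45 \<in> edges G0"
  "e2 \<in> edges G0" "\<epsilon> \<in> edges G0" "e4 \<in> edges G0"
  using joins_path joins_v by (simp_all add: joins_def)

lemma vertex_neq [simp]:
  "u1 \<noteq> u2" "u1 \<noteq> u3" "u1 \<noteq> u4" "u1 \<noteq> u5" "u2 \<noteq> u3" "u2 \<noteq> u4" "u2 \<noteq> u5" "u3 \<noteq> u4" "u3 \<noteq> u5" "u4 \<noteq> u5"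
  "v2 \<noteq> u1" "v2 \<noteq> u2" "v2 \<noteq> u3" "v2 \<noteq> u4" "v2 \<noteq> u5"
  "v3 \<noteq> u1" "v3 \<noteq> u2" "v3 \<noteq> u3" "v3 \<noteq> u4" "v3 \<noteq> u5"
  "v4 \<noteq> u1" "v4 \<noteq> u2" "v4 \<noteq> u3" "v4 \<noteq> u4" "v4 \<noteq> u5"
  using distinct_u v_not_u by auto

lemmas vertex_neq_sym [simp] = vertex_neq[symmetric]

lemma distinct_path: "distinct [e12, e23, e34, e45, e2, \<epsilon>, e4]"
proof -
  have "distinct (map (ends G0) [e12, e23, e34, e45, e2, \<epsilon>, e4])"
    by (simp add: doubleton_eq_iff)
  then show ?thesis by (simp only: distinct_map)
qed

lemma edge_neq [simp]:
  "e12 \<noteq> e23" "e12 \<noteq> e34" "e12 \<noteq> e45" "e12 \<noteq> e2" "e12 \<noteq> \<epsilon>" "e12 \<noteq> e4"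
  "e23 \<noteq> e34" "e23 \<noteq> e45" "e23 \<noteq> e2" "e23 \<noteq> \<epsilon>" "e23 \<noteq> e4"
  "e34 \<noteq> e45" "e34 \<noteq> e2" "e34 \<noteq> \<epsilon>" "e34 \<noteq> e4" "e45 \<noteq> e2" "e45 \<noteq> \<epsilon>" "e45 \<noteq> e4"
  "e2 \<noteq> \<epsilon>" "e2 \<noteq> e4" "\<epsilon> \<noteq> e4"
  using distinct_path by simp_all

lemmas edge_neq_sym [simp] = edge_neq[symmetric]

lemma finite_incident: "finite (incident G0 w)"
  by (rule finite_subset[OF incident_subset finite_edges])

lemma incident_cubicI:
  assumes "w \<in> verts G0" "f \<in> incident G0 w" "g \<in> incident G0 w" "h \<in> incident G0 w" "distinct [f, g, h]"
  shows "incident G0 w = {f, g, h}"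
proof (rule card_seteq[symmetric])
  show "card (incident G0 w) \<le> card {f, g, h}" using cubic3[OF assms(1)] assms(5) by simp
qed (use assms finite_incident in auto)

lemma path_verts: "u1 \<in> verts G0" "u2 \<in> verts G0" "u3 \<in> verts G0" "u4 \<in> verts G0" "v3 \<in> verts G0"
  using ends_verts[of e12] ends_verts[of e34] ends_verts[of \<epsilon>] by auto

lemma incident_path:
  "incident G0 u2 = {e12, e23, e2}" "incident G0 u3 = {e23, e34, \<epsilon>}" "incident G0 u4 = {e34, e45, e4}"
proof -
  show "incident G0 u2 = {e12, e23, e2}"
    by (rule incident_cubicI) (simp_all add: path_verts incident_def)
  show "incident G0 u3 = {e23, e34, \<epsilon>}"
    by (rule incident_cubicI) (simp_all add: path_verts incident_def)
  show "incident G0 u4 = {e34, e45, e4}"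
    by (rule incident_cubicI) (simp_all add: path_verts incident_def)
qed

section \<open>Edges and incidences of the superposition\<close>

definition G :: "('v + tvert, ('v, 'e) sup_edge) graph" where
  "G = superposition G0 u1 u2 u3 u4 u5 v2 v3 v4"

text \<open>The edges with a counterpart in \<open>G\<close>: only the two edges inside the deleted
  path disappear, the others survive or become links.\<close>

definition H :: "'e set" where
  "H = edges G0 - {e23, e34}"

lemma H_path: "{e12, e2, \<epsilon>, e4, e45} \<subseteq> H"
  by (simp add: H_def)

definition base :: "'e \<Rightarrow> ('v, 'e) sup_edge" where
  "base f = (if f = e12 then Link u1 Ta else if f = e2 then Link v2 Tb else if f = \<epsilon> then Link v3 Tc
     else if f = e4 then Link v4 Td else if f = e45 then Link u5 Te else Base f)"

text \<open>A loop in \<open>gadget_edges\<close> stands for the link at its vertex; the last branch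
  is meant for \<open>(Te, Te)\<close>, the only loop then left.\<close>

definition gadget :: "tvert \<times> tvert \<Rightarrow> ('v, 'e) sup_edge" where
  "gadget = (\<lambda>(s, t). if s \<noteq> t then Gadget {s, t}
     else if s = Ta then base e12 else if s = Tb then base e2 else if s = Td then base e4 else base e45)"

lemma base_path: "base e12 = Link u1 Ta" "base e2 = Link v2 Tb" "base \<epsilon> = Link v3 Tc"
  "base e4 = Link v4 Td" "base e45 = Link u5 Te"
  by (simp_all add: base_def)

lemma base_Base: "f \<notin> {e12, e2, \<epsilon>, e4, e45} \<Longrightarrow> base f = Base f"
  by (simp add: base_def)

lemma inj_base: "inj base"
  by (rule injI) (auto simp: base_def split: if_splits)

lemma gadget_port: "gadget (Ta, Ta) = base e12" "gadget (Tb, Tb) = base e2"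
  "gadget (Td, Td) = base e4" "gadget (Te, Te) = base e45"
  by (simp_all add: gadget_def)

lemma gadget_image:
  "gadget ` set gadget_edges = Gadget ` T_edges \<union> base ` {e12, e2, e4, e45}"
  unfolding gadget_edges_def T_edges_def
  by (simp add: gadget_def insert_commute)

lemma inj_on_gadget: "inj_on gadget (set gadget_edges)"
proof -
  have "distinct (map gadget gadget_edges)"
    by (simp add: gadget_edges_def gadget_def doubleton_eq_iff base_path)
  then show ?thesis by (simp add: distinct_map)
qed

text \<open>The two images overlap exactly in the four links at \<open>Ta\<close>,
  \<open>Tb\<close>, \<open>Td\<close>, \<open>Te\<close>, where a colouring of the base and one of
  the gadget have to agree.\<close>

lemma edges_G: "edges G = base ` H \<union> gadget ` set gadget_edges"
proof -
  have avoid: "ends G0 f \<inter> {u2, u3, u4} = {} \<longleftrightarrow> f \<notin> {e12, e23, e34, e45, e2, \<epsilon>, e4}" if "f \<in> edges G0" for f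
  proof -
    have "ends G0 f \<inter> {u2, u3, u4} = {} \<longleftrightarrow>
        f \<notin> incident G0 u2 \<and> f \<notin> incident G0 u3 \<and> f \<notin> incident G0 u4"
      using that by (auto simp: incident_def)
    then show ?thesis unfolding incident_path by blast
  qed
  have "Base ` {f \<in> edges G0. ends G0 f \<inter> {u2, u3, u4} = {}} =
      base ` (edges G0 - {e12, e23, e34, e45, e2, \<epsilon>, e4})"
    using avoid by (intro image_cong) (auto simp: base_Base)
  moreover have "{Link u1 Ta, Link v2 Tb, Link v3 Tc, Link v4 Td, Link u5 Te} = base ` {e12, e2, \<epsilon>, e4, e45}"
    by (simp add: base_path)
  moreover have "H = (edges G0 - {e12, e23, e34, e45, e2, \<epsilon>, e4}) \<union> {e12, e2, \<epsilon>, e4, e45}"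
    by (auto simp: H_def)
  ultimately show ?thesis
    unfolding G_def superposition_def gadget_image by auto
qed

lemma ends_G_base:
  "ends G (base f) = (if f = e12 then {Inl u1, Inr Ta} else if f = e2 then {Inl v2, Inr Tb}
     else if f = \<epsilon> then {Inl v3, Inr Tc} else if f = e4 then {Inl v4, Inr Td}
     else if f = e45 then {Inl u5, Inr Te} else Inl ` ends G0 f)"
  by (simp add: G_def superposition_def base_def)

lemma ends_G_Gadget: "ends G (Gadget x) = Inr ` x"
  by (simp add: G_def superposition_def)

lemma Inl_ends_base: "Inl w \<in> ends G (base f) \<longleftrightarrow> w \<in> ends G0 f - {u2, u3, u4}" if "f \<in> H"
proof (cases "f \<in> {e12, e2, \<epsilon>, e4, e45}")
  case True
  then show ?thesis by (auto simp: ends_G_base)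
next
  case False
  have "f \<notin> incident G0 u2" "f \<notin> incident G0 u3" "f \<notin> incident G0 u4"
    using that False unfolding incident_path by (auto simp: H_def)
  then have "u2 \<notin> ends G0 f" "u3 \<notin> ends G0 f" "u4 \<notin> ends G0 f"
    using that by (auto simp: H_def incident_def)
  then show ?thesis using False by (auto simp: ends_G_base)
qed

lemma ends_G_gadget:
  assumes "f \<in> set gadget_edges"
  shows "Inr t \<in> ends G (gadget f) \<longleftrightarrow> t = fst f \<or> t = snd f"
proof (cases "fst f = snd f")
  case False
  then show ?thesis by (cases f) (auto simp: gadget_def ends_G_Gadget)
next
  case True
  then have "f \<in> {(Ta, Ta), (Tb, Tb), (Td, Td), (Te, Te)}"
    using assms by (auto simp: gadget_edges_def)
  then show ?thesis by (auto simp: gadget_port ends_G_base)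
qed

lemma incident_H: "incident G0 w \<subseteq> H" if "w \<notin> {u2, u3, u4}"
  using that by (auto simp: incident_def H_def)

lemma incident_G_Inl:
  "incident G (Inl w) = (if w \<in> {u2, u3, u4} then {} else base ` incident G0 w)"
proof -
  have "Inl w \<notin> ends G (Gadget x)" for x by (auto simp: ends_G_Gadget)
  then have "incident G (Inl w) = {y \<in> base ` H. Inl w \<in> ends G y}"
    using H_path unfolding incident_def edges_G gadget_image by blast
  also have "\<dots> = base ` {f \<in> H. w \<in> ends G0 f - {u2, u3, u4}}"
    using Inl_ends_base by auto
  also have "\<dots> = (if w \<in> {u2, u3, u4} then {} else base ` incident G0 w)"
    using incident_H[of w] by (auto simp: incident_def H_def)
  finally show ?thesis .
qed

lemma Inr_ends_base: "Inr t \<in> ends G (base f) \<Longrightarrow> f \<in> {e12, e2, \<epsilon>, e4, e45}"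
  by (auto simp: ends_G_base split: if_splits)

lemma base_port: "f \<in> {e12, e2, e4, e45} \<Longrightarrow> base f \<in> gadget ` set gadget_edges"
  unfolding gadget_image by blast

text \<open>The link at \<open>Tc\<close> has no loop in \<open>gadget_edges\<close>, so it is added
  separately.\<close>

lemma incident_G_Inr:
  "incident G (Inr t) = gadget ` {f \<in> set gadget_edges. t = fst f \<or> t = snd f} \<union> (if t = Tc then {base \<epsilon>} else {})"
proof -
  have eps: "Inr t \<in> ends G (base \<epsilon>) \<longleftrightarrow> t = Tc"
    by (auto simp: ends_G_base)
  have "y \<in> incident G (Inr t) \<longleftrightarrow>
      y \<in> {y \<in> gadget ` set gadget_edges. Inr t \<in> ends G y} \<union> (if t = Tc then {base \<epsilon>} else {})" for y
  proof
    assume "y \<in> incident G (Inr t)"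
    then have y: "y \<in> base ` H \<union> gadget ` set gadget_edges" "Inr t \<in> ends G y"
      by (simp_all add: incident_def edges_G)
    show "y \<in> {y \<in> gadget ` set gadget_edges. Inr t \<in> ends G y} \<union> (if t = Tc then {base \<epsilon>} else {})"
    proof (cases "y \<in> gadget ` set gadget_edges")
      case False
      then obtain f where f: "y = base f" using y by blast
      then have "f = \<epsilon>" using Inr_ends_base[of t f] base_port[of f] y False by auto
      then show ?thesis using f y eps by simp
    qed (use y in simp)
  next
    assume y: "y \<in> {y \<in> gadget ` set gadget_edges. Inr t \<in> ends G y} \<union> (if t = Tc then {base \<epsilon>} else {})"
    have "\<epsilon> \<in> H" using H_path by blast
    then show "y \<in> incident G (Inr t)"
      using y eps by (auto simp: incident_def edges_G split: if_splits)
  qed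
  then have "incident G (Inr t) =
      {y \<in> gadget ` set gadget_edges. Inr t \<in> ends G y} \<union> (if t = Tc then {base \<epsilon>} else {})" by blast
  moreover have "{y \<in> gadget ` set gadget_edges. Inr t \<in> ends G y} =
      gadget ` {f \<in> set gadget_edges. t = fst f \<or> t = snd f}"
    using ends_G_gadget[of _ t] by auto
  ultimately show ?thesis by simp
qed

lemma base_not_gadget:
  assumes "f \<notin> {e12, e2, e4, e45}"
  shows "base f \<notin> gadget ` set gadget_edges"
proof
  assume "base f \<in> gadget ` set gadget_edges"
  moreover have "base f \<noteq> Gadget x" for x by (simp add: base_def)
  ultimately have "base f \<in> base ` {e12, e2, e4, e45}" unfolding gadget_image by auto
  then show False using assms inj_base by (auto dest: injD)
qed

section \<open>Subtracting \<open>base \<epsilon>\<close> from the superposition\<close>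

lemma edges_G_cut: "edges G - {base \<epsilon>} = base ` (H - {\<epsilon>}) \<union> gadget ` set gadget_edges"
proof -
  have "base \<epsilon> \<notin> gadget ` set gadget_edges" by (intro base_not_gadget) simp
  moreover have "base ` H - {base \<epsilon>} = base ` (H - {\<epsilon>})" using inj_base by (auto dest: injD)
  ultimately show ?thesis unfolding edges_G by blast
qed

lemma ends_G_eps: "ends G (base \<epsilon>) = {Inl v3, Inr Tc}"
  by (simp add: ends_G_base)

text \<open>Every image under \<open>base\<close> of an edge in \<open>H\<close> has an end in the
  old graph, while a proper gadget edge has none; so parallel edges could only occur within one
  kind, where the ends determine the edge.\<close>

lemma edge_cut_G: "edge_cut G (base \<epsilon>)"
proof
  have gadget_cases: "y \<in> Gadget ` T_edges \<or> (\<exists>f\<in>H. y = base f)" if "y \<in> edges G" for y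
    using that H_path unfolding edges_G gadget_image by blast
  have T: "card x = 2" if "x \<in> T_edges" for x
    using that by (auto simp: T_edges_def)
  show "card (ends G y) = 2" if "y \<in> edges G" for y
    using gadget_cases[OF that]
  proof (elim disjE bexE)
    assume "y \<in> Gadget ` T_edges"
    then show ?thesis using T by (auto simp: ends_G_Gadget card_image)
  next
    fix f assume "f \<in> H" "y = base f"
    then show ?thesis using card_ends[of f] by (simp add: ends_G_base card_image H_def)
  qed
  show "inj_on (ends G) (edges G)"
  proof (rule inj_onI)
    fix y z assume yz: "y \<in> edges G" "z \<in> edges G" and eq: "ends G y = ends G z"
    have base_gadget: "ends G (base f) \<noteq> ends G (Gadget x)" if "f \<in> H" for f x
    proof -
      have f: "f \<in> edges G0" using that by (simp add: H_def)
      obtain a b where "ends G0 f = {a, b}" using card_ends[OF f] by (auto simp: card_2_iff)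
      then have "\<exists>w. Inl w \<in> ends G (base f)" by (auto simp: ends_G_base)
      then show ?thesis by (auto simp: ends_G_Gadget)
    qed
    have base_base: "f = g" if fg: "f \<in> H" "g \<in> H" and eq: "ends G (base f) = ends G (base g)" for f g
    proof (cases "f \<in> {e12, e2, \<epsilon>, e4, e45} \<or> g \<in> {e12, e2, \<epsilon>, e4, e45}")
      case True
      then show ?thesis using eq by (auto simp: ends_G_base split: if_splits)
    next
      case False
      then have "Inl ` ends G0 f = (Inl ` ends G0 g :: ('v + tvert) set)" using eq by (simp add: ends_G_base)
      then have "ends G0 f = ends G0 g" by (simp add: inj_image_eq_iff)
      then show ?thesis using fg inj_ends by (auto simp: H_def dest: inj_onD)
    qed
    have gadget_gadget: "x = x'" if "ends G (Gadget x) = ends G (Gadget x')" for x x'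
      using that by (simp add: ends_G_Gadget inj_image_eq_iff)
    show "y = z"
      using gadget_cases[OF yz(1)] gadget_cases[OF yz(2)]
      by (elim disjE bexE imageE) (metis eq base_gadget base_base gadget_gadget)+
  qed
  show "base \<epsilon> \<in> edges G" by (simp add: edges_G H_def)
  show "incident G w \<noteq> {base \<epsilon>}" if "w \<in> ends G (base \<epsilon>)" for w
  proof -
    consider "w = Inl v3" | "w = Inr Tc" using \<open>w \<in> ends G (base \<epsilon>)\<close> by (auto simp: ends_G_eps)
    then show ?thesis
    proof cases
      case 1
      have "\<epsilon> \<in> incident G0 v3" by (simp add: incident_def)
      moreover have "incident G0 v3 \<noteq> {\<epsilon>}" using other_edge[of v3] by simp
      ultimately obtain f where "f \<in> incident G0 v3" "f \<noteq> \<epsilon>" by blast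
      then have "base f \<in> incident G w" "base f \<noteq> base \<epsilon>"
        using inj_base by (auto simp: 1 incident_G_Inl dest: injD)
      then show ?thesis by blast
    next
      case 2
      have "gadget (Th, Tc) \<in> incident G w"
        unfolding 2 incident_G_Inr by (intro UnI1 imageI) (simp add: gadget_edges_def)
      moreover have "gadget (Th, Tc) \<noteq> base \<epsilon>" by (simp add: gadget_def base_path)
      ultimately show ?thesis by blast
    qed
  qed
qed

text \<open>Conditions at old vertices concern only \<open>base\<close> edges and conditions at
  vertices of the gadget only \<open>gadget\<close> edges. The two halves are coupled through the
  shared links alone.\<close>

lemma cut_colourings_G_iff:
  assumes d: "d \<in> (edges G - {base \<epsilon>}) \<rightarrow>\<^sub>E {0, 1, 2}"
  shows "d \<in> cut_colourings G (base \<epsilon>) \<longleftrightarrow>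
    (\<forall>w. w \<notin> {u2, u3, u4, v3} \<longrightarrow> inj_on (d \<circ> base) (incident G0 w)) \<and>
    (\<forall>f\<in>incident G0 v3 - {\<epsilon>}. \<forall>g\<in>incident G0 v3 - {\<epsilon>}. d (base f) = d (base g)) \<and>
    restrict (d \<circ> gadget) (set gadget_edges) \<in> gadget_colourings"
proof -
  let ?L = "set gadget_edges"
  let ?at = "\<lambda>t. {f \<in> ?L. t = fst f \<or> t = snd f}"
  have Inl: "inj_on d (incident G (Inl w)) \<longleftrightarrow> w \<in> {u2, u3, u4} \<or> inj_on (d \<circ> base) (incident G0 w)" for w
    using comp_inj_on_iff[of base "incident G0 w" d] inj_base by (auto simp: incident_G_Inl inj_on_subset)
  have Inr: "inj_on d (incident G (Inr t)) \<longleftrightarrow> inj_on (restrict (d \<circ> gadget) ?L) (?at t)" if "t \<noteq> Tc" for t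
  proof -
    have "inj_on gadget (?at t)" using inj_on_gadget by (rule inj_on_subset) blast
    then have "inj_on d (gadget ` ?at t) \<longleftrightarrow> inj_on (d \<circ> gadget) (?at t)" by (rule comp_inj_on_iff)
    also have "\<dots> \<longleftrightarrow> inj_on (restrict (d \<circ> gadget) ?L) (?at t)" by (rule inj_on_cong) simp
    finally show ?thesis using that by (simp add: incident_G_Inr)
  qed
  have eps: "base \<epsilon> \<notin> gadget ` ?L" by (intro base_not_gadget) simp
  have v3: "incident G (Inl v3) - {base \<epsilon>} = base ` (incident G0 v3 - {\<epsilon>})"
    using inj_base by (auto simp: incident_G_Inl dest: injD)
  have "incident G (Inr Tc) - {base \<epsilon>} = gadget ` ?at Tc"
    unfolding incident_G_Inr if_P[OF refl] using eps by blast
  then have c: "incident G (Inr Tc) - {base \<epsilon>} = {gadget (Tc, Ti), gadget (Th, Tc)}"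
    by (simp only: gadget_edges_at_c image_insert image_empty)
  have range: "restrict (d \<circ> gadget) ?L \<in> ?L \<rightarrow>\<^sub>E {0, 1, 2}"
  proof (rule restrict_PiE_iff[THEN iffD2], rule ballI)
    fix f assume "f \<in> ?L"
    then have "gadget f \<in> edges G - {base \<epsilon>}" unfolding edges_G_cut by blast
    then show "(d \<circ> gadget) f \<in> {0, 1, 2}" using PiE_mem[OF d] by simp
  qed
  have at_ends: "(\<forall>w\<in>ends G (base \<epsilon>). \<forall>f\<in>incident G w - {base \<epsilon>}. \<forall>g\<in>incident G w - {base \<epsilon>}. d f = d g) \<longleftrightarrow>
      (\<forall>f\<in>incident G0 v3 - {\<epsilon>}. \<forall>g\<in>incident G0 v3 - {\<epsilon>}. d (base f) = d (base g)) \<and>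
      d (gadget (Th, Tc)) = d (gadget (Tc, Ti))"
    unfolding ends_G_eps by (simp only: ball_simps v3 c simp_thms) auto
  have off: "(\<forall>w. w \<notin> ends G (base \<epsilon>) \<longrightarrow> inj_on d (incident G w)) \<longleftrightarrow>
      (\<forall>w. w \<notin> {u2, u3, u4, v3} \<longrightarrow> inj_on (d \<circ> base) (incident G0 w)) \<and>
      (\<forall>t. t \<noteq> Tc \<longrightarrow> inj_on (restrict (d \<circ> gadget) ?L) (?at t))"
    unfolding ends_G_eps split_sum_all using Inl Inr by auto
  have "(Th, Tc) \<in> ?L" "(Tc, Ti) \<in> ?L" by (simp_all add: gadget_edges_def)
  then have hc: "restrict (d \<circ> gadget) ?L (Th, Tc) = d (gadget (Th, Tc))"
    "restrict (d \<circ> gadget) ?L (Tc, Ti) = d (gadget (Tc, Ti))" by simp_all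
  show ?thesis
    unfolding cut_colourings_def gadget_colourings_def mem_Collect_eq off at_ends hc using d range by argo
qed

text \<open>At \<open>u2\<close> the colour 2 is left for \<open>e23\<close>, it passes through the
  merged edge at \<open>u3\<close> to \<open>e34\<close>, and at \<open>u4\<close> the colours 0 and
  1 remain for \<open>e4\<close> and \<open>e45\<close>.\<close>

lemma cut_colouring_path:
  assumes d: "d \<in> cut_colourings G0 \<epsilon>" and e12: "d e12 = 0" and e2: "d e2 = 1"
  shows "d e23 = 2" "d e34 = 2" "d e4 = 0 \<and> d e45 = 1 \<or> d e4 = 1 \<and> d e45 = 0"
proof -
  have "inj_on d {e12, e23, e2}" "inj_on d {e34, e45, e4}"
    unfolding incident_path[symmetric] by (simp_all add: cut_colouring_inj[OF d])
  then have neq: "d e12 \<noteq> d e23" "d e23 \<noteq> d e2" "d e34 \<noteq> d e45" "d e34 \<noteq> d e4" "d e45 \<noteq> d e4"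
    by (simp_all add: inj_on_eq_iff)
  show e23: "d e23 = 2" using neq(1,2) cut_colouring_range[OF d, of e23] e12 e2 by simp
  have "d e34 = d e23"
    by (rule cut_colouring_eq[OF d, of u3]) (simp_all add: incident_path)
  then show e34: "d e34 = 2" using e23 by simp
  show "d e4 = 0 \<and> d e45 = 1 \<or> d e4 = 1 \<and> d e45 = 0"
    using neq(3-5) cut_colouring_range[OF d, of e4] cut_colouring_range[OF d, of e45] e34
    by auto
qed

text \<open>A colouring on the left is the same as a colouring on the right together with a gadget
  colouring that has the matching port colours, and there are always seven of the latter.\<close>

lemma card_cut_colourings_G:
  "card {d \<in> cut_colourings G (base \<epsilon>). d (base e12) = 0 \<and> d (base e2) = 1} =
    7 * card {d \<in> cut_colourings G0 \<epsilon>. d e12 = 0 \<and> d e2 = 1}"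
proof -
  let ?L = "set gadget_edges"
  define M where "M = {d \<in> cut_colourings G (base \<epsilon>). d (base e12) = 0 \<and> d (base e2) = 1}"
  define N where "N = {d \<in> cut_colourings G0 \<epsilon>. d e12 = 0 \<and> d e2 = 1}"
  define S where "S d = {c \<in> gadget_colourings. c (Ta, Ta) = 0 \<and> c (Tb, Tb) = 1 \<and>
    c (Td, Td) = d e4 \<and> c (Te, Te) = d e45}" for d :: "'e \<Rightarrow> nat"
  \<comment> \<open>The edges \<open>e23\<close> and \<open>e34\<close> are absent from
    \<open>G\<close>; the value 2 is the one forced by \<open>cut_colouring_path\<close>.\<close>
  define pull where
    "pull d = restrict (\<lambda>f. if f = e23 \<or> f = e34 then 2 else d (base f)) (edges G0 - {\<epsilon>})"
    for d :: "('v, 'e) sup_edge \<Rightarrow> nat"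
  define \<Psi> where "\<Psi> d = (pull d, restrict (d \<circ> gadget) ?L)" for d
  have port: "(Ta, Ta) \<in> ?L" "(Tb, Tb) \<in> ?L" "(Td, Td) \<in> ?L" "(Te, Te) \<in> ?L"
    by (simp_all add: gadget_edges_def)
  have M_dom: "d \<in> (edges G - {base \<epsilon>}) \<rightarrow>\<^sub>E {0, 1, 2}" if "d \<in> M" for d
    using that unfolding M_def cut_colourings_def by blast
  have N_dom: "d \<in> (edges G0 - {\<epsilon>}) \<rightarrow>\<^sub>E {0, 1, 2}" if "d \<in> N" for d
    using that unfolding N_def cut_colourings_def by blast
  have base_edge: "base f \<in> edges G - {base \<epsilon>}" if "f \<in> H" "f \<noteq> \<epsilon>" for f
    using that unfolding edges_G_cut by blast
  have pull_H: "pull d f = d (base f)" if "f \<in> H" "f \<noteq> \<epsilon>" for d f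
    using that by (simp add: pull_def H_def)
  have into: "\<Psi> d \<in> Sigma N S" if d: "d \<in> M" for d
  proof -
    have val: "d (base e12) = 0" "d (base e2) = 1" using d by (simp_all add: M_def)
    let ?c = "restrict (d \<circ> gadget) ?L"
    have "d \<in> cut_colourings G (base \<epsilon>)" using d by (simp add: M_def)
    note cut = this[unfolded cut_colourings_G_iff[OF M_dom[OF d]]]
    then have c: "?c \<in> gadget_colourings" by blast
    have cval: "?c (Ta, Ta) = 0" "?c (Tb, Tb) = 1" "?c (Td, Td) = d (base e4)" "?c (Te, Te) = d (base e45)"
      using port val by (simp_all add: gadget_port)
    \<comment> \<open>The gadget transmits the colours 0 and 1 to the ports at \<open>Td\<close> and
      \<open>Te\<close>, so that colour 2 is free for \<open>e34\<close> at
      \<open>u4\<close>.\<close>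
    have e4: "d (base e4) = 0 \<and> d (base e45) = 1 \<or> d (base e4) = 1 \<and> d (base e45) = 0"
      using gadget_port_colours(2)[OF c] unfolding cval .
    have bval: "pull d e12 = 0" "pull d e2 = 1" "pull d e23 = 2" "pull d e34 = 2"
        "pull d e4 = d (base e4)" "pull d e45 = d (base e45)"
      using val by (simp_all add: pull_def)
    have "pull d \<in> cut_colourings G0 \<epsilon>"
      unfolding cut_colourings_def
    proof (intro CollectI conjI allI impI ballI)
      show "pull d \<in> (edges G0 - {\<epsilon>}) \<rightarrow>\<^sub>E {0, 1, 2}"
        unfolding pull_def
      proof (rule restrict_PiE_iff[THEN iffD2], rule ballI)
        fix f assume f: "f \<in> edges G0 - {\<epsilon>}"
        show "(if f = e23 \<or> f = e34 then 2 else d (base f)) \<in> {0, 1, 2}"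
        proof (cases "f = e23 \<or> f = e34")
          case False
          then have "f \<in> H" "f \<noteq> \<epsilon>" using f by (auto simp: H_def)
          then show ?thesis using PiE_mem[OF M_dom[OF d] base_edge[of f]] False by simp
        qed simp
      qed
    next
      fix w assume w: "w \<notin> ends G0 \<epsilon>"
      consider "w = u2" | "w = u4" | "w \<notin> {u2, u3, u4, v3}" using w by auto
      then show "inj_on (pull d) (incident G0 w)"
      proof cases
        case 1
        then show ?thesis using bval by (simp add: incident_path)
      next
        case 2
        then show ?thesis using bval e4 by (auto simp: incident_path)
      next
        case 3
        then have sub: "incident G0 w \<subseteq> H - {\<epsilon>}" using incident_H[of w] by (auto simp: incident_def)
        have "(d \<circ> base) f = pull d f" if "f \<in> incident G0 w" for f
          using subsetD[OF sub that] by (simp add: pull_H)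
        moreover have "inj_on (d \<circ> base) (incident G0 w)" using cut 3 by blast
        ultimately show ?thesis by (rule inj_on_cong[THEN iffD1])
      qed
    next
      fix w f g assume w: "w \<in> ends G0 \<epsilon>" and f: "f \<in> incident G0 w - {\<epsilon>}" and g: "g \<in> incident G0 w - {\<epsilon>}"
      consider "w = u3" | "w = v3" using w by auto
      then show "pull d f = pull d g"
      proof cases
        case 1
        then show ?thesis using f g bval by (auto simp: incident_path)
      next
        case 2
        then have "f \<in> H" "g \<in> H" using f g incident_H[of v3] by auto
        moreover have "d (base f) = d (base g)" using cut f g 2 by blast
        ultimately show ?thesis using f g pull_H by simp
      qed
    qed
    then have "pull d \<in> N" using bval by (simp add: N_def)
    moreover have "?c \<in> S (pull d)" unfolding S_def mem_Collect_eq bval cval using c by simp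
    ultimately show ?thesis by (simp add: \<Psi>_def)
  qed
  have "bij_betw \<Psi> M (Sigma N S)"
  proof (rule bij_betw_imageI)
    show "inj_on \<Psi> M"
    proof (rule inj_onI)
      fix d d' assume d: "d \<in> M" "d' \<in> M" and "\<Psi> d = \<Psi> d'"
      then have eq: "pull d = pull d'" "restrict (d \<circ> gadget) ?L = restrict (d' \<circ> gadget) ?L"
        by (simp_all add: \<Psi>_def)
      show "d = d'"
      proof (rule PiE_ext[OF M_dom[OF d(1)] M_dom[OF d(2)]])
        fix y assume "y \<in> edges G - {base \<epsilon>}"
        then consider f where "y = base f" "f \<in> H" "f \<noteq> \<epsilon>" | f where "y = gadget f" "f \<in> ?L"
          unfolding edges_G_cut by blast
        then show "d y = d' y"
        proof cases
          case 1
          then show ?thesis using fun_cong[OF eq(1), of f] pull_H by simp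
        next
          case 2
          then show ?thesis using fun_cong[OF eq(2), of f] by simp
        qed
      qed
    qed
    have "z \<in> \<Psi> ` M" if z: "z \<in> Sigma N S" for z
    proof -
      obtain d0 c where dc: "z = (d0, c)" "d0 \<in> N" "c \<in> S d0" using z by blast
      \<comment> \<open>The two colourings are glued. On the shared links the value is taken from
        \<open>c\<close>, which agrees with \<open>d0\<close> there by the definitions of
        \<open>N\<close> and \<open>S\<close>.\<close>
      define d where "d = restrict (\<lambda>y. if y \<in> gadget ` ?L then c (inv_into ?L gadget y)
        else d0 (inv base y)) (edges G - {base \<epsilon>})"
      have d0: "d0 \<in> cut_colourings G0 \<epsilon>" "d0 e12 = 0" "d0 e2 = 1" using dc(2) by (simp_all add: N_def)
      have c: "c \<in> gadget_colourings" "c (Ta, Ta) = 0" "c (Tb, Tb) = 1" "c (Td, Td) = d0 e4" "c (Te, Te) = d0 e45"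
        using dc(3) by (simp_all add: S_def)
      have c_dom: "c \<in> ?L \<rightarrow>\<^sub>E {0, 1, 2}" using c(1) unfolding gadget_colourings_def by blast
      have dg: "d (gadget f) = c f" if "f \<in> ?L" for f
        using that inv_into_f_f[OF inj_on_gadget] by (simp add: d_def edges_G_cut)
      have db: "d (base f) = d0 f" if f: "f \<in> H" "f \<noteq> \<epsilon>" for f
      proof (cases "f \<in> {e12, e2, e4, e45}")
        case True
        then show ?thesis
          using dg[OF port(1)] dg[OF port(2)] dg[OF port(3)] dg[OF port(4)] c d0 by (auto simp: gadget_port)
      next
        case False
        then show ?thesis
          using base_not_gadget[OF False] base_edge[OF f] inj_base by (simp add: d_def)
      qed
      have d_dom: "d \<in> (edges G - {base \<epsilon>}) \<rightarrow>\<^sub>E {0, 1, 2}"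
      proof (rule PiE_I)
        fix y assume "y \<in> edges G - {base \<epsilon>}"
        then consider f where "y = base f" "f \<in> H" "f \<noteq> \<epsilon>" | f where "y = gadget f" "f \<in> ?L"
          unfolding edges_G_cut by blast
        then show "d y \<in> {0, 1, 2}"
        proof cases
          case 1
          then show ?thesis using db[of f] cut_colouring_range[OF d0(1), of f] by (simp add: H_def)
        next
          case 2
          then show ?thesis using dg[of f] PiE_mem[OF c_dom, of f] by simp
        qed
      qed (auto simp: d_def)
      have "d \<in> cut_colourings G (base \<epsilon>)"
        unfolding cut_colourings_G_iff[OF d_dom]
      proof (intro conjI allI impI ballI)
        fix w assume w: "w \<notin> {u2, u3, u4, v3}"
        then have "inj_on d0 (incident G0 w)" by (intro cut_colouring_inj[OF d0(1)]) simp
        moreover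
        have sub: "incident G0 w \<subseteq> H - {\<epsilon>}" using incident_H[of w] w by (auto simp: incident_def)
        have "d0 f = (d \<circ> base) f" if "f \<in> incident G0 w" for f
          using subsetD[OF sub that] by (simp add: db)
        ultimately show "inj_on (d \<circ> base) (incident G0 w)" using inj_on_cong by blast
      next
        fix f g assume f: "f \<in> incident G0 v3 - {\<epsilon>}" and g: "g \<in> incident G0 v3 - {\<epsilon>}"
        have "d0 f = d0 g" by (rule cut_colouring_eq[OF d0(1), of v3]) (use f g in auto)
        moreover have "f \<in> H" "g \<in> H" using f g incident_H[of v3] by auto
        ultimately show "d (base f) = d (base g)" using db f g by simp
      next
        have "restrict (d \<circ> gadget) ?L = c"
          using dg PiE_arb[OF c_dom] by (intro ext) (simp add: restrict_def)
        then show "restrict (d \<circ> gadget) ?L \<in> gadget_colourings" using c(1) by simp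
      qed
      moreover have "d (base e12) = 0" "d (base e2) = 1"
        using db[of e12] db[of e2] d0 H_path by simp_all
      ultimately have dM: "d \<in> M" by (simp add: M_def)
      have "pull d f = d0 f" for f
      proof (cases "f \<in> edges G0 - {\<epsilon>}")
        case True
        then show ?thesis
          using db[of f] cut_colouring_path(1,2)[OF d0] by (auto simp: pull_def H_def)
      next
        case False
        then show ?thesis using PiE_arb[OF N_dom[OF dc(2)], of f] unfolding pull_def by auto
      qed
      moreover have "restrict (d \<circ> gadget) ?L = c"
        using dg PiE_arb[OF c_dom] by (intro ext) (simp add: restrict_def)
      ultimately have "\<Psi> d = z" unfolding \<Psi>_def dc(1) by auto
      then show ?thesis using dM by blast
    qed
    then show "\<Psi> ` M = Sigma N S" using into by blast
  qed
  then have "card M = card (Sigma N S)" by (rule bij_betw_same_card)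
  also have "\<dots> = (\<Sum>d\<in>N. card (S d))"
  proof (rule card_SigmaI)
    show "finite N"
    proof (rule finite_subset)
      show "N \<subseteq> (edges G0 - {\<epsilon>}) \<rightarrow>\<^sub>E {0, 1, 2}" using N_dom by blast
      show "finite ((edges G0 - {\<epsilon>}) \<rightarrow>\<^sub>E {0, 1, 2 :: nat})" using finite_edges by (intro finite_PiE) simp_all
    qed
    show "\<forall>d\<in>N. finite (S d)" using finite_gadget_colourings by (simp add: S_def)
  qed
  also have "\<dots> = (\<Sum>d\<in>N. 7)"
  proof (rule sum.cong[OF refl])
    fix d assume "d \<in> N"
    then have d: "d \<in> cut_colourings G0 \<epsilon>" "d e12 = 0" "d e2 = 1" by (simp_all add: N_def)
    have p: "d e4 = 0 \<and> d e45 = 1 \<or> d e4 = 1 \<and> d e45 = 0" using cut_colouring_path(3)[OF d] .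
    have "card (S d) = (if (0::nat) \<noteq> 1 \<and> (d e4 = 0 \<and> d e45 = 1 \<or> d e4 = 1 \<and> d e45 = 0) then 7 else 0)"
      unfolding S_def by (rule card_gadget_colourings) (use p in auto)
    then show "card (S d) = 7" using p by simp
  qed
  finally show ?thesis by (simp add: M_def N_def)
qed

lemma psi_G: "psi G (base \<epsilon>) = 7 * psi G0 \<epsilon>"
proof -
  let ?N = "{d \<in> cut_colourings G0 \<epsilon>. d e12 = 0 \<and> d e2 = 1}"
  have "3 dvd card ?N"
  \<comment> \<open>The vertex \<open>w\<close> of the lemma is \<open>u2\<close>, and the edge from
    it to an end of \<epsilon> is \<open>e23\<close>.\<close>
  proof (rule three_dvd_cut_colourings)
    show "ends G0 \<epsilon> = {u3, v3}" "u3 \<noteq> v3" by simp_all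
    show "incident G0 u2 = {e12, e2, e23}" by (simp add: incident_path insert_commute)
    show "u2 \<notin> ends G0 \<epsilon>" by simp
    show "distinct [e12, e2, e23]" by simp
    show "u3 \<in> ends G0 e23" by simp
  qed
  then obtain k where k: "card ?N = 3 * k" by blast
  have "card {P. edge_decomposition3 (subtract_edge G0 \<epsilon>) P} = card ?N"
  proof (rule card_decompositions_subtract)
    show "e12 \<in> edges G0 - {\<epsilon>}" "e2 \<in> edges G0 - {\<epsilon>}" by simp_all
    show "d e12 \<noteq> d e2" if "d \<in> cut_colourings G0 \<epsilon>" for d
    proof -
      have "inj_on d {e12, e23, e2}"
        unfolding incident_path[symmetric] using that by (intro cut_colouring_inj) simp_all
      then show ?thesis by (simp add: inj_on_eq_iff)
    qed
    show "u2 \<notin> ends G0 \<epsilon>" by simp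
    show "card (incident G0 u2) = 3" using path_verts by (intro cubic3)
  qed
  then have psi0: "psi G0 \<epsilon> = k" unfolding psi_def k by simp
  interpret G: edge_cut G "base \<epsilon>" by (rule edge_cut_G)
  have "card {P. edge_decomposition3 (subtract_edge G (base \<epsilon>)) P} =
    card {d \<in> cut_colourings G (base \<epsilon>). d (base e12) = 0 \<and> d (base e2) = 1}"
  proof (rule G.card_decompositions_subtract)
    have "e12 \<in> H - {\<epsilon>}" "e2 \<in> H - {\<epsilon>}" using H_path by simp_all
    then show "base e12 \<in> edges G - {base \<epsilon>}" "base e2 \<in> edges G - {base \<epsilon>}"
      unfolding edges_G_cut by blast+
    \<comment> \<open>These two links have no common vertex; it is the gadget that forces their
      colours apart.\<close>
    show "d (base e12) \<noteq> d (base e2)" if d: "d \<in> cut_colourings G (base \<epsilon>)" for d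
    proof -
      have "d \<in> (edges G - {base \<epsilon>}) \<rightarrow>\<^sub>E {0, 1, 2}" using d unfolding cut_colourings_def by blast
      then have "restrict (d \<circ> gadget) (set gadget_edges) \<in> gadget_colourings"
        using d cut_colourings_G_iff by blast
      from gadget_port_colours(1)[OF this] show ?thesis by (simp add: gadget_edges_def gadget_port)
    qed
    \<comment> \<open>Since \<open>u2\<close> is deleted in \<open>G\<close>, the vertex
      \<open>u1\<close> serves as the vertex of degree 3 off the subtracted edge.\<close>
    show "Inl u1 \<notin> ends G (base \<epsilon>)" by (simp add: ends_G_eps)
    have "card (base ` incident G0 u1) = card (incident G0 u1)"
      by (rule card_image) (rule inj_on_subset[OF inj_base subset_UNIV])
    also have "\<dots> = 3" using path_verts by (intro cubic3)
    finally show "card (incident G (Inl u1)) = 3" by (simp add: incident_G_Inl)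
  qed
  then have "card {P. edge_decomposition3 (subtract_edge G (base \<epsilon>)) P} = 3 * (7 * k)"
    using card_cut_colourings_G k by simp
  then have "psi G (base \<epsilon>) = 7 * k" unfolding psi_def by simp
  then show ?thesis by (simp add: psi0)
qed

end

theorem theorem5p1:
  fixes G0 :: "('v, 'e) graph"
    and G :: "('v + tvert, ('v, 'e) sup_edge) graph"
    and u1 u2 u3 u4 u5 v2 v3 v4 :: 'v
    and E :: "('v, 'e) sup_edge" and \<epsilon> :: 'e
  assumes "snark G0"
    and "distinct [u1, u2, u3, u4, u5]"
    and "\<exists>e. joins G0 e u1 u2" and "\<exists>e. joins G0 e u2 u3"
    and "\<exists>e. joins G0 e u3 u4" and "\<exists>e. joins G0 e u4 u5"
    and "{v2, v3, v4} \<inter> {u1, u2, u3, u4, u5} = {}"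
    and "\<exists>e. joins G0 e u2 v2" and "\<exists>e. joins G0 e u4 v4"
    and "joins G0 \<epsilon> u3 v3"
    and "G = superposition G0 u1 u2 u3 u4 u5 v2 v3 v4"
    and "joins G E (Inl v3) (Inr Tc)"
  shows "psi G E = 7 * psi G0 \<epsilon>"
proof -
  obtain e12 e23 e34 e45 e2 e4 where
    e: "joins G0 e12 u1 u2" "joins G0 e23 u2 u3" "joins G0 e34 u3 u4" "joins G0 e45 u4 u5"
      "joins G0 e2 u2 v2" "joins G0 e4 u4 v4"
    using assms(3-6,8,9) by blast
  have simple: "simple_graph G0" and cub: "cubic G0" and unc: "\<not> edge_colourable3 G0"
    using assms(1) by (simp_all add: snark_def)
  have card2: "card (ends G0 f) = 2" and sub: "ends G0 f \<subseteq> verts G0" if "f \<in> edges G0" for f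
    using simple that by (simp_all add: simple_graph_def wf_graph_def)
  have inj: "inj_on (ends G0) (edges G0)" and fin: "finite (verts G0)"
    using simple by (simp_all add: simple_graph_def)
  have cubic3: "card (incident G0 w) = 3" if "w \<in> verts G0" for w
    using cub that by (simp add: cubic_def incident_def)
  have "finite (edges G0)"
  proof (rule inj_on_finite[OF inj])
    show "ends G0 ` edges G0 \<subseteq> Pow (verts G0)" using sub by blast
  qed (use fin in simp)
  moreover have "\<epsilon> \<in> edges G0" using assms(10) by (simp add: joins_def)
  moreover have "incident G0 w \<noteq> {\<epsilon>}" if "w \<in> ends G0 \<epsilon>" for w
    using cubic3[of w] that sub[OF \<open>\<epsilon> \<in> edges G0\<close>] by auto
  ultimately interpret S: superposed_path G0 \<epsilon> u1 u2 u3 u4 u5 v2 v3 v4 e12 e23 e34 e45 e2 e4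
    using assms(2,7,10) e card2 sub inj cubic3 unc by unfold_locales simp_all
  have G: "G = S.G" using assms(11) by (simp add: S.G_def)
  \<comment> \<open>Without parallel edges, \<open>E\<close> is identified by its two ends.\<close>
  have "E = S.base \<epsilon>"
  proof (rule inj_onD[OF edge_cut.inj_ends[OF S.edge_cut_G]])
    show "ends S.G E = ends S.G (S.base \<epsilon>)" "E \<in> edges S.G"
      using assms(12) by (simp_all add: G joins_def S.ends_G_eps)
    show "S.base \<epsilon> \<in> edges S.G" by (rule edge_cut.e_edge[OF S.edge_cut_G])
  qed
  then show ?thesis using S.psi_G G by simp
qed

end
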